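(* For all $m=0,1,\ldots$ and $0<\xi<\infty$, $$\frac1\pi\int_0^\infty\frac{\sqrt\eta\,e^{-\eta}\,\Phi(1/2-m,3/2;\eta)\,d\eta}{\eta-\xi}=\frac{\sqrt\pi}{2}\,e^{-\xi}L_m^{-1/2}(\xi),$$ $$\frac1\pi\int_0^\infty\frac{e^{-\eta}\,\Phi(-1/2-m,1/2;\eta)\,d\eta}{\sqrt\eta\,(\eta-\xi)}=-\sqrt\pi\,e^{-\xi}L_m^{1/2}(\xi).$$
   Context: The integrals are Cauchy principal values. $L_m^\alpha(x)=\sum_{k=0}^m\binom{m+\alpha}{m-k}\frac{(-1)^kx^k}{k!}$ are the (generalized) Laguerre polynomials, with $\binom{a}{n}=\frac{\Gamma(a+1)}{n!\,\Gamma(a-n+1)}$. $\Phi(a,c;x)=\sum_{k=0}^\infty \frac{(a)_k x^k}{(c)_k k!}$ is the confluent hypergeometric function, $(a)_k=a(a+1)\cdots(a+k-1)$. *)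

theory Defs
  imports "HOL-Analysis.Analysis" "HOL-Real_Asymp.Real_Asymp"
begin

(* The library's gchoose equals Gamma (a + 1) / (fact n * Gamma (a - n + 1)) whenever
   a + 1 is not a pole of Gamma (lemma gbinomial_Gamma; laguerre_Gamma below). *)
definition laguerre :: "nat \<Rightarrow> real \<Rightarrow> real \<Rightarrow> real" where
  "laguerre m \<alpha> x =
     (\<Sum>k=0..m. ((real m + \<alpha>) gchoose (m - k)) * ((-1) ^ k * x ^ k / fact k))"

(* Meaningful for c not in {0, -1, -2, ...}, where the series converges for all x
   (confluent_hyp_sums below). *)
definition confluent_hyp :: "real \<Rightarrow> real \<Rightarrow> real \<Rightarrow> real" where
  "confluent_hyp a c x = (\<Sum>k. pochhammer a k * x ^ k / (pochhammer c k * fact k))"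

(* Cauchy principal value over S with the one singular point \<xi>: a symmetric interval around
   \<xi> is removed, and the remaining integrals are Lebesgue integrals. *)
definition has_pv_integral :: "(real \<Rightarrow> real) \<Rightarrow> real set \<Rightarrow> real \<Rightarrow> real \<Rightarrow> bool" where
  "has_pv_integral f S \<xi> I \<longleftrightarrow>
     (\<forall>\<epsilon>>0. set_integrable lborel (S - {\<xi> - \<epsilon><..<\<xi> + \<epsilon>}) f) \<and>
     ((\<lambda>\<epsilon>. set_lebesgue_integral lborel (S - {\<xi> - \<epsilon><..<\<xi> + \<epsilon>}) f) \<longlongrightarrow> I) (at_right 0)"

definition pv_integrable :: "(real \<Rightarrow> real) \<Rightarrow> real set \<Rightarrow> real \<Rightarrow> bool" where
  "pv_integrable f S \<xi> \<longleftrightarrow> (\<exists>I. has_pv_integral f S \<xi> I)"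

definition pv_integral :: "(real \<Rightarrow> real) \<Rightarrow> real set \<Rightarrow> real \<Rightarrow> real" where
  "pv_integral f S \<xi> = (THE I. has_pv_integral f S \<xi> I)"

lemma has_pv_integral_unique:
  assumes "has_pv_integral f S \<xi> I" "has_pv_integral f S \<xi> J"
  shows "I = J"
  using assms unfolding has_pv_integral_def
  by (meson tendsto_unique trivial_limit_at_right_real)

lemma pv_integral_eqI: "has_pv_integral f S \<xi> I \<Longrightarrow> pv_integral f S \<xi> = I"
  unfolding pv_integral_def by (blast intro: the_equality has_pv_integral_unique)

lemma laguerre_Gamma:
  assumes "real m + \<alpha> + 1 \<notin> \<int>\<^sub>\<le>\<^sub>0"
  shows "laguerre m \<alpha> x =
    (\<Sum>k=0..m. Gamma (real m + \<alpha> + 1) / (fact (m - k) * Gamma (real m + \<alpha> - real (m - k) + 1))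
        * ((-1) ^ k * x ^ k / fact k))"
  unfolding laguerre_def using assms by (intro sum.cong refl) (simp add: gbinomial_Gamma)

lemma confluent_hyp_sums:
  fixes a c x :: real
  assumes c: "c \<notin> \<int>\<^sub>\<le>\<^sub>0"
  shows "(\<lambda>k. pochhammer a k * x ^ k / (pochhammer c k * fact k)) sums confluent_hyp a c x"
proof -
  define t where "t = (\<lambda>k. pochhammer a k * x ^ k / (pochhammer c k * fact k))"
  define q where "q = (\<lambda>k. (a + real k) * x / ((c + real k) * (1 + real k)))"
  have rec: "t (Suc k) = q k * t k" for k
    by (simp add: t_def q_def pochhammer_Suc algebra_simps)
  have "q \<longlonglongrightarrow> 0" unfolding q_def by real_asymp
  then have "\<forall>\<^sub>F k in sequentially. norm (q k) < 1/2"
    by (auto simp: tendsto_iff dist_norm dest: spec[of _ "1/2"])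
  then obtain N where N: "\<And>k. k \<ge> N \<Longrightarrow> norm (q k) < 1/2"
    by (auto simp: eventually_sequentially)
  have "summable t"
  proof (rule summable_ratio_test[of "1/2" N])
    show "norm (t (Suc n)) \<le> 1/2 * norm (t n)" if "n \<ge> N" for n
      unfolding rec norm_mult using N[OF that] by (intro mult_right_mono) auto
  qed auto
  then show ?thesis
    by (simp add: t_def confluent_hyp_def summable_sums)
qed

end

(* With eta = s^2, Kummer's transformation and termwise integration identify both numerators with
   the oscillatory Gaussian integrals G(s), the integral of u^n exp(-u^2) sin(2us + phi) over u > 0,
   and the two right-hand sides with such integrals whose phase is shifted by pi/2. The Hilbert
   transform maps sin(2us + phi) to cos(2ux + phi): in

     PV int G(s)/(s - x) ds = int_{t > 0} (G(x + t) - G(x - t))/t dt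

   Fubini's theorem on 0 < t < N leaves the sine integral Si(2uN), which is bounded and tends to
   pi/2. The parity of G folds the real line onto the half-line. *)

theory Submission
  imports Defs "HOL-Probability.Sinc_Integral"
begin

subsection \<open>Confluent hypergeometric functions and Gaussian integrals\<close>

text \<open>One exponent n serves both sides of each identity. Up to elementary factors, Kummer's
  transformation turns the numerators into Phi(m + 1, 3/2; -s^2) and Phi(m + 1, 1/2; -s^2), which
  are the sine transform for n = 2m and the cosine transform for n = 2m + 1. For the same n the
  other transform is e^(-x^2) times a terminating series, that is, a Laguerre polynomial. The phase
  shift sends sine to cosine but cosine to minus sine, whence the minus sign of the second formula.

  Two obstacles shape the rest. The factor sin(2ut)/t is not absolutely integrable for large t, so
  Fubini's theorem needs the cut-off N; removing it requires the symmetric quotient to be integrable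
  in t, which rests on a Lipschitz bound for small t and on the boundedness of s G(s) for large t.
  Moreover, squaring does not carry symmetric holes to symmetric holes, so the principal values in s
  and in \<eta> are limits over different truncations, and their difference has to be
  estimated.\<close>

lemma pochhammer_vandermonde_alternating:
  fixes b c :: real
  assumes c: "c \<notin> \<int>\<^sub>\<le>\<^sub>0"
  shows "(\<Sum>k\<le>n. (-1) ^ k * pochhammer b k / (pochhammer c k * fact k * fact (n - k)))
         = pochhammer (c - b) n / (pochhammer c n * fact n)"
proof -
  have cn: "pochhammer c k \<noteq> 0" for k
    using c by (auto simp: pochhammer_eq_0_iff)
  \<comment> \<open>The upper arguments -b and c + n - 1 are chosen so that the two binomials equal
    (-1)^k (b)_k / k! and (c)_n / ((c)_k (n - k)!); dividing by (c)_n gives the required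
    summands.\<close>
  have "(\<Sum>k=0..n. (- b gchoose k) * ((c + real n - 1) gchoose (n - k)))
      = (c - b + real n - 1) gchoose n"
    by (subst gbinomial_Vandermonde) (simp add: algebra_simps)
  also have "\<dots> = pochhammer (c - b) n / fact n"
    by (simp add: gbinomial_pochhammer' algebra_simps)
  finally have *: "(\<Sum>k=0..n. (- b gchoose k) * ((c + real n - 1) gchoose (n - k)))
      = pochhammer (c - b) n / fact n" .
  have "(\<Sum>k\<le>n. (-1) ^ k * pochhammer b k / (pochhammer c k * fact k * fact (n - k)))
      = (\<Sum>k=0..n. (- b gchoose k) * ((c + real n - 1) gchoose (n - k)) / pochhammer c n)"
  proof (intro sum.cong)
    fix k assume "k \<in> {0..n}"
    then have k: "k \<le> n" by simp
    have "(c + real n - 1) gchoose (n - k) = pochhammer (c + real k) (n - k) / fact (n - k)"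
      using k by (simp add: gbinomial_pochhammer' of_nat_diff algebra_simps)
    moreover have "pochhammer c n = pochhammer c k * pochhammer (c + real k) (n - k)"
      using k by (rule pochhammer_product)
    ultimately show "(-1) ^ k * pochhammer b k / (pochhammer c k * fact k * fact (n - k))
      = (- b gchoose k) * ((c + real n - 1) gchoose (n - k)) / pochhammer c n"
      using cn[of n] by (simp add: gbinomial_pochhammer field_simps)
  qed auto
  also have "\<dots> = pochhammer (c - b) n / (pochhammer c n * fact n)"
    unfolding sum_divide_distrib[symmetric] * by (simp add: field_simps)
  finally show ?thesis .
qed

lemma abs_pochhammer_le: "\<bar>pochhammer a k\<bar> \<le> pochhammer \<bar>a\<bar> k" for a :: real
proof (induction k)
  case (Suc k)
  have "\<bar>a + real k\<bar> \<le> \<bar>a\<bar> + real k" by linarith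
  moreover have "0 \<le> pochhammer \<bar>a\<bar> k" using Suc by (rule order_trans[OF abs_ge_zero])
  ultimately show ?case
    using Suc by (auto simp: pochhammer_Suc abs_mult intro!: mult_mono)
qed simp

lemma pos_not_nonpos_Ints: "c > 0 \<Longrightarrow> c \<notin> \<int>\<^sub>\<le>\<^sub>0" for c :: real
  by (auto simp: nonpos_Ints_def)

text \<open>Cauchy product of the two power series: the n-th coefficient is the alternating
  Vandermonde sum with b = c - a, which collapses to (a)_n because c - b = a.\<close>

lemma confluent_hyp_kummer:
  fixes a c x :: real
  assumes c: "c > 0"
  shows "exp (-x) * confluent_hyp (c - a) c x = confluent_hyp a c (-x)"
proof -
  have c': "c \<notin> \<int>\<^sub>\<le>\<^sub>0" using c by (rule pos_not_nonpos_Ints)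
  have cpos: "pochhammer c k > 0" for k
    using c by (rule pochhammer_pos)
  define p where "p = (\<lambda>b y k. pochhammer b k * y ^ k / (pochhammer c k * fact k) :: real)"
  define e where "e = (\<lambda>k. (-x) ^ k /\<^sub>R fact k)"
  have p: "p b y sums confluent_hyp b c y" for b y
    unfolding p_def by (rule confluent_hyp_sums[OF c'])
  \<comment> \<open>The majorant is again a confluent hypergeometric series, at \<bar>c - a\<bar>
    and \<bar>x\<bar>; all \<open>pochhammer c k\<close> are positive, so absolute values affect the
    numerators only.\<close>
  have sp: "summable (\<lambda>k. norm (p (c - a) x k))"
  proof (rule summable_comparison_test')
    show "summable (p \<bar>c - a\<bar> \<bar>x\<bar>)" using p by (rule sums_summable)
    show "norm (norm (p (c - a) x k)) \<le> p \<bar>c - a\<bar> \<bar>x\<bar> k" for k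
      using abs_pochhammer_le[of "c - a" k] cpos[of k]
      by (auto simp: p_def abs_mult power_abs intro!: divide_right_mono mult_right_mono)
  qed
  have "summable (\<lambda>k. norm (e k))" unfolding e_def by (rule summable_norm_exp)
  then have "(\<lambda>n. \<Sum>k\<le>n. p (c - a) x k * e (n - k)) sums (suminf (p (c - a) x) * suminf e)"
    by (rule Cauchy_product_sums[OF sp])
  moreover have "(\<Sum>k\<le>n. p (c - a) x k * e (n - k)) = p a (-x) n" for n
  proof -
    have "(\<Sum>k\<le>n. p (c - a) x k * e (n - k)) = (-x) ^ n *
       (\<Sum>k\<le>n. (-1) ^ k * pochhammer (c - a) k / (pochhammer c k * fact k * fact (n - k)))"
      unfolding sum_distrib_left
    proof (intro sum.cong refl)
      fix k assume "k \<in> {..n}"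
      then have "x ^ k * (-x) ^ (n - k) = (-x) ^ n * (-1) ^ k"
        by (simp add: power_minus[of x] power_add[symmetric] uminus_power_if)
      then show "p (c - a) x k * e (n - k) = (-x) ^ n *
          ((-1) ^ k * pochhammer (c - a) k / (pochhammer c k * fact k * fact (n - k)))"
        by (simp add: p_def e_def divide_inverse mult_ac)
    qed
    then show ?thesis
      by (simp add: pochhammer_vandermonde_alternating[OF c'] p_def)
  qed
  ultimately have "p a (-x) sums (suminf (p (c - a) x) * suminf e)" by simp
  moreover have "suminf (p (c - a) x) = confluent_hyp (c - a) c x"
    using p by (rule sums_unique[symmetric])
  moreover have "suminf e = exp (-x)" by (simp add: e_def exp_def)
  ultimately show ?thesis using p[of a "-x"] by (metis sums_unique2 mult.commute)
qed

text \<open>The symbol (-m)_k vanishes for k > m, so the series is a finite sum, and it agrees with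
  the Laguerre sum term by term.\<close>

lemma laguerre_eq_confluent_hyp:
  assumes \<alpha>: "\<alpha> > -1"
  shows "laguerre m \<alpha> x = pochhammer (\<alpha> + 1) m / fact m * confluent_hyp (- real m) (\<alpha> + 1) x"
proof -
  have pos: "pochhammer (\<alpha> + 1) k > 0" for k
    using \<alpha> by (intro pochhammer_pos) simp
  have "confluent_hyp (- real m) (\<alpha> + 1) x
      = (\<Sum>k=0..m. pochhammer (- real m) k * x ^ k / (pochhammer (\<alpha> + 1) k * fact k))"
    unfolding confluent_hyp_def
    by (rule suminf_finite) (auto simp: pochhammer_of_nat_eq_0_iff)
  moreover have "((real m + \<alpha>) gchoose (m - k)) * ((-1) ^ k * x ^ k / fact k)
      = pochhammer (\<alpha> + 1) m / fact m *
        (pochhammer (- real m) k * x ^ k / (pochhammer (\<alpha> + 1) k * fact k))" if k: "k \<le> m" for k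
  proof -
    have "(real m + \<alpha>) gchoose (m - k) = pochhammer (\<alpha> + 1 + real k) (m - k) / fact (m - k)"
      using k by (simp add: gbinomial_pochhammer' of_nat_diff algebra_simps)
    moreover have "pochhammer (\<alpha> + 1) m = pochhammer (\<alpha> + 1) k * pochhammer (\<alpha> + 1 + real k) (m - k)"
      using k by (rule pochhammer_product)
    moreover have "pochhammer (- real m) k = (-1) ^ k * (fact m / fact (m - k))"
    proof -
      have "(real m gchoose k) = fact m / (fact k * fact (m - k))"
        using k by (simp add: binomial_gbinomial[symmetric] binomial_fact)
      then have "(-1) ^ k * pochhammer (- real m) k = fact m / fact (m - k)"
        by (simp add: gbinomial_pochhammer field_simps)
      then have "(-1) ^ k * ((-1) ^ k * pochhammer (- real m) k) = (-1) ^ k * (fact m / fact (m - k))"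
        by simp
      then show ?thesis
        by (simp add: mult.assoc[symmetric] power_mult_distrib[symmetric])
    qed
    ultimately show ?thesis using pos[of k] by simp
  qed
  ultimately show ?thesis
    by (simp add: laguerre_def sum_distrib_left)
qed

section \<open>Gaussian moments on the half-line and termwise integration\<close>

definition gaussian_weight :: "nat \<Rightarrow> real \<Rightarrow> real" where
  "gaussian_weight n u = indicator {0..} u * (u ^ n * exp (- u\<^sup>2))"

definition gaussian_moment :: "nat \<Rightarrow> real" where
  "gaussian_moment n = (\<integral>u. gaussian_weight n u \<partial>lborel)"

text \<open>The phase is a parameter so that \<phi> = 0 (sine), \<phi> = pi/2 (cosine) and their
  Hilbert transforms are instances of one function; the transform then acts as \<phi> to \<phi> +
  pi/2, up to the factor pi.\<close>

definition gaussian_osc :: "nat \<Rightarrow> real \<Rightarrow> real \<Rightarrow> real" where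
  "gaussian_osc n \<phi> s = (\<integral>u. gaussian_weight n u * sin (2 * u * s + \<phi>) \<partial>lborel)"

lemma gaussian_weight_nonneg [simp]: "gaussian_weight n u \<ge> 0"
  by (auto simp: gaussian_weight_def indicator_def)

lemma gaussian_weight_measurable [measurable]: "gaussian_weight n \<in> borel_measurable borel"
  unfolding gaussian_weight_def by measurable

lemma gaussian_weight_add: "gaussian_weight (n + k) u = gaussian_weight n u * u ^ k"
  by (simp add: gaussian_weight_def power_add)

lemma has_bochner_integral_gaussian_weight_even:
  "has_bochner_integral lborel (gaussian_weight (2 * k)) (sqrt pi / 2 * pochhammer (1/2) k)"
proof -
  have "fact (2 * k) / (2 ^ (2 * k) * fact k) = (pochhammer (1/2) k :: real)"
    by (subst fact_double) simp
  moreover have "gaussian_weight (2 * k) =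
      (\<lambda>x. indicator {0..} x *\<^sub>R (exp (- x\<^sup>2) * x ^ (2 * k)))"
    by (auto simp: gaussian_weight_def fun_eq_iff)
  ultimately show ?thesis using gaussian_moment_even_pos[of k] by simp
qed

lemma has_bochner_integral_gaussian_weight_odd:
  "has_bochner_integral lborel (gaussian_weight (2 * k + 1)) (fact k / 2)"
proof -
  have "gaussian_weight (2 * k + 1) =
      (\<lambda>x. indicator {0..} x *\<^sub>R (exp (- x\<^sup>2) * x ^ (2 * k + 1)))"
    by (auto simp: gaussian_weight_def fun_eq_iff)
  then show ?thesis using gaussian_moment_odd_pos[of k] by simp
qed

lemma integrable_gaussian_weight [simp]: "integrable lborel (gaussian_weight n)"
proof (cases "even n")
  case True
  then obtain k where "n = 2 * k" by (auto elim: evenE)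
  then show ?thesis using has_bochner_integral_gaussian_weight_even[of k] by (auto intro: integrable.intros)
next
  case False
  then obtain k where "n = 2 * k + 1" by (auto elim: oddE)
  then show ?thesis using has_bochner_integral_gaussian_weight_odd[of k] by (auto intro: integrable.intros)
qed

lemma gaussian_moment_even: "gaussian_moment (2 * k) = sqrt pi / 2 * pochhammer (1/2) k"
  unfolding gaussian_moment_def
  by (rule has_bochner_integral_integral_eq[OF has_bochner_integral_gaussian_weight_even])

lemma gaussian_moment_odd: "gaussian_moment (2 * k + 1) = fact k / 2"
  unfolding gaussian_moment_def
  by (rule has_bochner_integral_integral_eq[OF has_bochner_integral_gaussian_weight_odd])

lemma gaussian_moment_add_2: "gaussian_moment (n + 2) = (real n + 1) / 2 * gaussian_moment n"
proof (cases "even n")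
  case True
  then obtain k where "n = 2 * k" by (auto elim: evenE)
  then show ?thesis using gaussian_moment_even[of k] gaussian_moment_even[of "k + 1"]
    by (simp add: pochhammer_Suc field_simps)
next
  case False
  then obtain k where "n = 2 * k + 1" by (auto elim: oddE)
  then show ?thesis using gaussian_moment_odd[of k] gaussian_moment_odd[of "k + 1"]
    by (simp add: field_simps)
qed

text \<open>This is where the numerator Pochhammer symbol of the confluent hypergeometric series
  comes from: integrating the powers of a sine or cosine series against the weight multiplies the
  k-th coefficient by it.\<close>

lemma gaussian_moment_add_double:
  "gaussian_moment (n + 2 * k) = pochhammer ((real n + 1) / 2) k * gaussian_moment n"
proof (induction k)
  case (Suc k)
  have "gaussian_moment (n + 2 * Suc k) = gaussian_moment ((n + 2 * k) + 2)" by simp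
  then show ?case unfolding gaussian_moment_add_2 Suc
    by (simp add: pochhammer_Suc field_simps)
qed simp

text \<open>Used with j = 1 for the sine and j = 0 for the cosine. \<open>sums_integral\<close> asks
  for absolute convergence at each point, supplied by \<open>abs\<close>, and for summable integrals
  of the absolute values, supplied by \<open>s\<close>.\<close>

lemma gaussian_weight_power_series:
  assumes f: "\<And>u. (\<lambda>k. a k * u ^ (2 * k + j)) sums f u"
    and abs: "\<And>u. summable (\<lambda>k. \<bar>a k\<bar> * \<bar>u\<bar> ^ (2 * k + j))"
    and s: "summable (\<lambda>k. \<bar>a k\<bar> * pochhammer ((real (n + j) + 1) / 2) k)"
  shows "(\<lambda>k. a k * pochhammer ((real (n + j) + 1) / 2) k * gaussian_moment (n + j)) sums
           (\<integral>u. gaussian_weight n u * f u \<partial>lborel)"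
proof -
  define g where "g = (\<lambda>k u. a k * gaussian_weight (n + j + 2 * k) u)"
  have g: "g k u = gaussian_weight n u * (a k * u ^ (2 * k + j))" for k u
    by (simp add: g_def gaussian_weight_add power_add mult_ac)
  have gs: "(\<lambda>k. g k u) sums (gaussian_weight n u * f u)" for u
    unfolding g by (intro sums_mult f)
  \<comment> \<open>The factor \<open>b\<close> stays free because the formula is applied both to
    the terms and, with \<bar>a k\<bar>, to their norms.\<close>
  have int: "(\<integral>u. b * gaussian_weight (n + j + 2 * k) u \<partial>lborel) =
      b * pochhammer ((real (n + j) + 1) / 2) k * gaussian_moment (n + j)" for k b
    using gaussian_moment_add_double[of "n + j" k] by (simp add: gaussian_moment_def)
  have "(\<lambda>k. \<integral>u. g k u \<partial>lborel) sums (\<integral>u. (\<Sum>k. g k u) \<partial>lborel)"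
  proof (rule sums_integral)
    show "integrable lborel (g k)" for k unfolding g_def by simp
    have "summable (\<lambda>k. norm (g k u))" for u
      unfolding g using summable_mult[OF abs, of "gaussian_weight n u" u]
      by (simp add: abs_mult power_abs)
    then show "AE u in lborel. summable (\<lambda>k. norm (g k u))" by simp
    have "(\<integral>u. norm (g k u) \<partial>lborel) =
        gaussian_moment (n + j) * (\<bar>a k\<bar> * pochhammer ((real (n + j) + 1) / 2) k)" for k
      unfolding g_def using int[of "\<bar>a k\<bar>" k] by (simp add: abs_mult mult_ac)
    then show "summable (\<lambda>k. \<integral>u. norm (g k u) \<partial>lborel)"
      using s by (simp add: summable_mult)
  qed
  moreover have "(\<Sum>k. g k u) = gaussian_weight n u * f u" for u
    using gs by (rule sums_unique[symmetric])
  ultimately show ?thesis by (simp only: g_def int)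
qed

text \<open>The power 4^k cancels the 2^(2k) from the frequency 2us. This explains the 2 in
  \<open>gaussian_osc\<close>: the integrated series has argument exactly -s^2.\<close>

lemma fact_double_Suc_pochhammer: "fact (2 * k + 1) = (4 ^ k * fact k * pochhammer (3/2) k :: real)"
  by (induction k) (simp_all add: pochhammer_Suc field_simps)

lemma fact_double_pochhammer_half: "fact (2 * k) = (4 ^ k * fact k * pochhammer (1/2) k :: real)"
  by (subst fact_double) (simp add: power_mult)

lemma confluent_hyp_summable:
  fixes a c x :: real
  assumes "c > 0"
  shows "summable (\<lambda>k. pochhammer a k * x ^ k / (pochhammer c k * fact k))"
  using confluent_hyp_sums[OF pos_not_nonpos_Ints[OF assms]] by (rule sums_summable)

text \<open>Comparison with the exponential series at u^2; \<open>b k\<close> will be the factorial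
  of 2k or 2k + 1.\<close>

lemma summable_fact_even_powers:
  fixes u :: real
  assumes "\<And>k. b k \<ge> (fact k :: real)"
  shows "summable (\<lambda>k. 1 / b k * \<bar>u\<bar> ^ (2 * k + j))"
proof (rule summable_comparison_test')
  show "summable (\<lambda>k. \<bar>u\<bar> ^ j * (inverse (fact k) * (u\<^sup>2) ^ k))"
    by (intro summable_mult summable_exp)
  fix k :: nat assume "k \<ge> 0"
  have "b k > 0" using assms[of k] fact_gt_zero[of k] by (metis less_le_trans)
  then have "1 / b k \<le> inverse (fact k)" using assms[of k] by (simp add: field_simps)
  then have "1 / b k * (\<bar>u\<bar> ^ j * (u\<^sup>2) ^ k) \<le> inverse (fact k) * (\<bar>u\<bar> ^ j * (u\<^sup>2) ^ k)"
    by (intro mult_right_mono) auto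
  moreover have "\<bar>u\<bar> ^ (2 * k + j) = \<bar>u\<bar> ^ j * (u\<^sup>2) ^ k"
    by (simp add: power_add power_mult power_even_abs)
  ultimately show "norm (1 / b k * \<bar>u\<bar> ^ (2 * k + j)) \<le> \<bar>u\<bar> ^ j * (inverse (fact k) * (u\<^sup>2) ^ k)"
    using \<open>b k > 0\<close> by (simp add: abs_mult mult_ac)
qed

lemma gaussian_osc_sin:
  "gaussian_osc n 0 s = 2 * s * gaussian_moment (n + 1) * confluent_hyp ((real n + 2) / 2) (3/2) (- s\<^sup>2)"
proof -
  define a where "a = (\<lambda>k. (-1) ^ k * (2 * s) ^ (2 * k + 1) / fact (2 * k + 1))"
  have a: "a k = 2 * s * ((- s\<^sup>2) ^ k / (pochhammer (3/2) k * fact k))" for k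
  proof -
    have "(2 * s) ^ (2 * k) = 4 ^ k * (s\<^sup>2) ^ k" by (simp add: power_mult power_mult_distrib)
    then show ?thesis
      unfolding a_def fact_double_Suc_pochhammer by (simp add: power_minus[of "s\<^sup>2"] mult_ac)
  qed
  have "(\<lambda>k. a k * pochhammer ((real (n + 1) + 1) / 2) k * gaussian_moment (n + 1)) sums
           (\<integral>u. gaussian_weight n u * sin (2 * u * s) \<partial>lborel)"
  proof (rule gaussian_weight_power_series)
    fix u :: real
    have "(\<lambda>k. (-1) ^ k * (2 * u * s) ^ (2 * k + 1) / fact (2 * k + 1)) sums sin (2 * u * s)"
      using sin_paired[of "2 * u * s"] by simp
    then show "(\<lambda>k. a k * u ^ (2 * k + 1)) sums sin (2 * u * s)"
      by (simp add: a_def power_mult_distrib mult_ac)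
    have "summable (\<lambda>k. 1 / fact (2 * k + 1) * \<bar>2 * s * u\<bar> ^ (2 * k + 1))"
      by (rule summable_fact_even_powers) (auto intro!: fact_mono simp del: fact_Suc)
    then show "summable (\<lambda>k. \<bar>a k\<bar> * \<bar>u\<bar> ^ (2 * k + 1))"
      by (simp add: a_def power_mult_distrib abs_mult power_abs mult_ac)
  next
    \<comment> \<open>After integration the absolute values form the same hypergeometric series at
      +s^2, which converges everywhere.\<close>
    have "summable (\<lambda>k. 2 * \<bar>s\<bar> *
        (pochhammer ((real (n + 1) + 1) / 2) k * (s\<^sup>2) ^ k / (pochhammer (3/2) k * fact k)))"
      by (intro summable_mult confluent_hyp_summable) simp
    then show "summable (\<lambda>k. \<bar>a k\<bar> * pochhammer ((real (n + 1) + 1) / 2) k)"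
      by (simp add: a abs_mult power_abs abs_of_nonneg pochhammer_nonneg mult_ac)
  qed
  moreover have "(\<lambda>k. a k * pochhammer ((real (n + 1) + 1) / 2) k * gaussian_moment (n + 1)) sums
     (2 * s * gaussian_moment (n + 1) * confluent_hyp ((real (n + 1) + 1) / 2) (3/2) (- s\<^sup>2))"
    using sums_mult[OF confluent_hyp_sums[OF pos_not_nonpos_Ints, of "3/2" "(real (n + 1) + 1) / 2" "- s\<^sup>2"], of "2 * s * gaussian_moment (n + 1)"]
    by (simp add: a mult_ac)
  ultimately show ?thesis
    using sums_unique2 by (fastforce simp: gaussian_osc_def add_ac)
qed

lemma gaussian_osc_cos:
  "gaussian_osc n (pi / 2) s = gaussian_moment n * confluent_hyp ((real n + 1) / 2) (1/2) (- s\<^sup>2)"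
proof -
  define a where "a = (\<lambda>k. (-1) ^ k * (2 * s) ^ (2 * k) / fact (2 * k))"
  have a: "a k = (- s\<^sup>2) ^ k / (pochhammer (1/2) k * fact k)" for k
  proof -
    have "(2 * s) ^ (2 * k) = 4 ^ k * (s\<^sup>2) ^ k" by (simp add: power_mult power_mult_distrib)
    then show ?thesis
      unfolding a_def fact_double_pochhammer_half by (simp add: power_minus[of "s\<^sup>2"] mult_ac)
  qed
  have "(\<lambda>k. a k * pochhammer ((real (n + 0) + 1) / 2) k * gaussian_moment (n + 0)) sums
           (\<integral>u. gaussian_weight n u * cos (2 * u * s) \<partial>lborel)"
  proof (rule gaussian_weight_power_series)
    fix u :: real
    have "(\<lambda>k. (-1) ^ k * (2 * u * s) ^ (2 * k) / fact (2 * k)) sums cos (2 * u * s)"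
      using cos_paired[of "2 * u * s"] by simp
    then show "(\<lambda>k. a k * u ^ (2 * k + 0)) sums cos (2 * u * s)"
      by (simp add: a_def power_mult_distrib mult_ac)
    have "summable (\<lambda>k. 1 / fact (2 * k) * \<bar>2 * s * u\<bar> ^ (2 * k + 0))"
      by (rule summable_fact_even_powers) (auto intro!: fact_mono simp del: fact_Suc)
    then show "summable (\<lambda>k. \<bar>a k\<bar> * \<bar>u\<bar> ^ (2 * k + 0))"
      by (simp add: a_def power_mult_distrib abs_mult power_abs mult_ac)
  next
    have "summable (\<lambda>k.
        (pochhammer ((real (n + 0) + 1) / 2) k * (s\<^sup>2) ^ k / (pochhammer (1/2) k * fact k)))"
      by (intro confluent_hyp_summable) simp
    then show "summable (\<lambda>k. \<bar>a k\<bar> * pochhammer ((real (n + 0) + 1) / 2) k)"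
      by (simp add: a abs_mult power_abs abs_of_nonneg pochhammer_nonneg mult_ac)
  qed
  moreover have "(\<lambda>k. a k * pochhammer ((real n + 1) / 2) k * gaussian_moment n) sums
     (gaussian_moment n * confluent_hyp ((real n + 1) / 2) (1/2) (- s\<^sup>2))"
    using sums_mult[OF confluent_hyp_sums[OF pos_not_nonpos_Ints, of "1/2" "(real n + 1) / 2" "- s\<^sup>2"], of "gaussian_moment n"]
    by (simp add: a mult_ac)
  ultimately show ?thesis
    using sums_unique2 by (fastforce simp: gaussian_osc_def sin_add)
qed

section \<open>Boundedness, Lipschitz continuity and decay of the oscillatory integrals\<close>

lemma integrable_gaussian_weight_bounded:
  fixes f :: "real \<Rightarrow> real"
  assumes [measurable]: "f \<in> borel_measurable borel" and B: "\<And>u. \<bar>f u\<bar> \<le> B"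
  shows "integrable lborel (\<lambda>u. gaussian_weight n u * f u)"
proof (rule Bochner_Integration.integrable_bound)
  show "integrable lborel (\<lambda>u. gaussian_weight n u * B)" by simp
  have "0 \<le> B" using B[of 0] by linarith
  then show "AE u in lborel. norm (gaussian_weight n u * f u) \<le> norm (gaussian_weight n u * B)"
    using B by (auto simp: abs_mult intro!: mult_left_mono)
qed measurable

lemma integrable_gaussian_osc: "integrable lborel (\<lambda>u. gaussian_weight n u * sin (2 * u * s + \<phi>))"
  by (rule integrable_gaussian_weight_bounded[where B = 1]) auto

lemma abs_gaussian_osc_le: "\<bar>gaussian_osc n \<phi> s\<bar> \<le> gaussian_moment n"
proof -
  have "\<bar>gaussian_osc n \<phi> s\<bar> \<le> (\<integral>u. \<bar>gaussian_weight n u * sin (2 * u * s + \<phi>)\<bar> \<partial>lborel)"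
    unfolding gaussian_osc_def by (rule integral_abs_bound)
  also have "\<dots> \<le> gaussian_moment n"
    unfolding gaussian_moment_def using integrable_gaussian_osc
    by (intro integral_mono integrable_abs) (auto simp: abs_mult intro!: mult_left_le)
  finally show ?thesis .
qed

lemma abs_sin_diff_le: "\<bar>sin x - sin y\<bar> \<le> \<bar>x - y\<bar>" for x y :: real
proof -
  have "\<bar>sin x - sin y\<bar> = 2 * (\<bar>sin ((x - y) / 2)\<bar> * \<bar>cos ((x + y) / 2)\<bar>)"
    by (simp add: sin_diff_sin abs_mult)
  also have "\<dots> \<le> 2 * (\<bar>(x - y) / 2\<bar> * 1)"
    by (intro mult_left_mono mult_mono abs_sin_x_le_abs_x) auto
  finally show ?thesis by simp
qed

text \<open>The sines differ by at most 2u\<bar>s - t\<bar>, and the extra u raises the exponent of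
  the weight to n + 1. Besides continuity, this bounds the symmetric quotient near its
  singularity.\<close>

lemma gaussian_osc_lipschitz:
  "\<bar>gaussian_osc n \<phi> s - gaussian_osc n \<phi> t\<bar> \<le> 2 * gaussian_moment (n + 1) * \<bar>s - t\<bar>"
proof -
  let ?f = "\<lambda>u. gaussian_weight n u * (sin (2 * u * s + \<phi>) - sin (2 * u * t + \<phi>))"
  have diff: "gaussian_osc n \<phi> s - gaussian_osc n \<phi> t = (\<integral>u. ?f u \<partial>lborel)"
    unfolding gaussian_osc_def
    unfolding right_diff_distrib
    by (rule Bochner_Integration.integral_diff[symmetric]) (rule integrable_gaussian_osc)+
  have "\<bar>gaussian_osc n \<phi> s - gaussian_osc n \<phi> t\<bar> \<le> (\<integral>u. \<bar>?f u\<bar> \<partial>lborel)"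
    unfolding diff by (rule integral_abs_bound)
  also have "\<dots> \<le> (\<integral>u. gaussian_weight (n + 1) u * (2 * \<bar>s - t\<bar>) \<partial>lborel)"
  proof (rule integral_mono)
    have "integrable lborel ?f"
      using Bochner_Integration.integrable_diff[OF integrable_gaussian_osc[of n s \<phi>] integrable_gaussian_osc[of n t \<phi>]]
      by (simp only: right_diff_distrib)
    then show "integrable lborel (\<lambda>u. \<bar>?f u\<bar>)" by simp
    fix u
    show "\<bar>?f u\<bar> \<le> gaussian_weight (n + 1) u * (2 * \<bar>s - t\<bar>)"
    proof (cases "u \<ge> 0")
      case True
      have "\<bar>sin (2 * u * s + \<phi>) - sin (2 * u * t + \<phi>)\<bar> \<le> \<bar>(2 * u * s + \<phi>) - (2 * u * t + \<phi>)\<bar>"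
        by (rule abs_sin_diff_le)
      also have "\<dots> = u * (2 * \<bar>s - t\<bar>)"
        using True by (simp add: abs_mult flip: right_diff_distrib)
      finally have "gaussian_weight n u * \<bar>sin (2 * u * s + \<phi>) - sin (2 * u * t + \<phi>)\<bar>
          \<le> gaussian_weight n u * (u * (2 * \<bar>s - t\<bar>))"
        by (intro mult_left_mono) auto
      then show ?thesis
        using gaussian_weight_add[of n 1 u] by (simp add: abs_mult mult.assoc)
    qed (simp add: gaussian_weight_def)
  qed simp
  also have "\<dots> = 2 * gaussian_moment (n + 1) * \<bar>s - t\<bar>"
    by (simp add: gaussian_moment_def)
  finally show ?thesis .
qed

lemma isCont_gaussian_osc: "isCont (gaussian_osc n \<phi>) s"
  unfolding isCont_def
proof (rule Lim_null[THEN iffD2], rule Lim_null_comparison)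
  show "\<forall>\<^sub>F t in at s. norm (gaussian_osc n \<phi> t - gaussian_osc n \<phi> s)
      \<le> 2 * gaussian_moment (n + 1) * \<bar>t - s\<bar>"
    using gaussian_osc_lipschitz by (intro always_eventually) auto
  show "((\<lambda>t. 2 * gaussian_moment (n + 1) * \<bar>t - s\<bar>) \<longlongrightarrow> 0) (at s)"
    by (auto intro!: tendsto_eq_intros)
qed

lemma gaussian_osc_measurable [measurable]: "gaussian_osc n \<phi> \<in> borel_measurable borel"
  by (intro borel_measurable_continuous_onI continuous_at_imp_continuous_on ballI isCont_gaussian_osc)

text \<open>One integration by parts in u: 2s sin(2us + \<phi>) is the derivative of -cos(2us +
  \<phi>), so 2s times the integral equals a boundary term plus the integral of the differentiated
  weight against a cosine, both bounded in s. This 1/\<bar>s\<bar> decay, together with the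
  1/\<bar>s - x\<bar> of the kernel, yields integrability at infinity.\<close>

lemma gaussian_osc_decay: "\<exists>K. \<forall>s. \<bar>s\<bar> * \<bar>gaussian_osc n \<phi> s\<bar> \<le> K"
proof -
  define w where "w = (\<lambda>n u::real. u ^ n * exp (- u\<^sup>2))"
  \<comment> \<open>The derivative of \<open>w n\<close>. For n = 0 the truncated exponent n - 1 is
    harmless, since its coefficient is 0.\<close>
  define w' where "w' = (\<lambda>u. real n * w (n - 1) u - 2 * w (n + 1) u)"
  have w'_int: "integrable lborel (\<lambda>u. indicator {0..} u * w' u)"
  proof -
    have "integrable lborel (\<lambda>u. real n * gaussian_weight (n - 1) u - 2 * gaussian_weight (n + 1) u)"
      by simp
    then show ?thesis
      by (simp add: gaussian_weight_def w'_def w_def algebra_simps)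
  qed
  define B where "B = (\<integral>u. \<bar>indicator {0..} u * w' u\<bar> \<partial>lborel)"
  have main: "2 * (s * gaussian_osc n \<phi> s) =
     w n 0 * cos \<phi> + (\<integral>u. indicator {0..} u * w' u * cos (2 * u * s + \<phi>) \<partial>lborel)" for s
  proof -
    define F where "F = (\<lambda>u. - w n u * cos (2 * u * s + \<phi>))"
    define f where "f = (\<lambda>u. 2 * s * (w n u * sin (2 * u * s + \<phi>)) - w' u * cos (2 * u * s + \<phi>))"
    have i1: "integrable lborel (\<lambda>u. indicator {0..} u * (w n u * sin (2 * u * s + \<phi>)))"
      using integrable_gaussian_osc[of n s \<phi>] by (simp add: gaussian_weight_def w_def mult.assoc)
    have i2: "integrable lborel (\<lambda>u. indicator {0..} u * (w' u * cos (2 * u * s + \<phi>)))"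
    proof (rule Bochner_Integration.integrable_bound[OF w'_int])
      show "(\<lambda>u. indicator {0..} u * (w' u * cos (2 * u * s + \<phi>))) \<in> borel_measurable lborel"
        unfolding w'_def w_def by measurable
      show "AE u in lborel. norm (indicator {0..} u * (w' u * cos (2 * u * s + \<phi>)))
          \<le> norm (indicator {0..} u * w' u)"
        by (auto simp: abs_mult indicator_def intro!: mult_left_le)
    qed
    have "integrable lborel (\<lambda>u. 2 * s * (indicator {0..} u * (w n u * sin (2 * u * s + \<phi>)))
        - indicator {0..} u * (w' u * cos (2 * u * s + \<phi>)))"
      using i1 i2 by simp
    then have fi: "set_integrable lborel {0..} f"
      unfolding set_integrable_def f_def by (simp add: algebra_simps)
    have "(LBINT u=0..\<infinity>. f u) = 0 - F 0"
    proof (rule interval_integral_FTC_integrable)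
      show "(F has_vector_derivative f u) (at u)" for u
      proof -
        have w: "(w n has_real_derivative w' u) (at u)"
          unfolding w_def w'_def
          by (auto intro!: derivative_eq_intros simp: algebra_simps power_Suc)
        have "(F has_real_derivative f u) (at u)"
          unfolding F_def f_def
          by (rule derivative_eq_intros w refl)+ (simp add: algebra_simps)
        then show ?thesis
          by (simp add: has_real_derivative_iff_has_vector_derivative)
      qed
      show "isCont f u" for u
        unfolding f_def w'_def w_def by (intro continuous_intros)
      show "set_integrable lborel (einterval 0 \<infinity>) f"
        by (rule set_integrable_subset[OF fi]) (auto simp: einterval_def zero_ereal_def)
      have "isCont F 0" unfolding F_def w_def by (intro continuous_intros)
      then have "(F \<longlongrightarrow> F 0) (at_right 0)"
        unfolding isCont_def by (rule filterlim_mono) (auto simp: at_le)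
      then show "((F \<circ> real_of_ereal) \<longlongrightarrow> F 0) (at_right 0)"
        by (simp add: zero_ereal_def ereal_tendsto_simps)
      have "(w n \<longlongrightarrow> 0) at_top" unfolding w_def by real_asymp
      then have "((\<lambda>u. - w n u * cos (2 * u * s + \<phi>)) \<longlongrightarrow> 0) at_top"
        by (rule Lim_null_comparison[where g = "\<lambda>u. \<bar>w n u\<bar>", rotated, OF tendsto_rabs_zero])
           (auto simp: abs_mult intro!: mult_left_le always_eventually)
      then show "((F \<circ> real_of_ereal) \<longlongrightarrow> 0) (at_left \<infinity>)"
        unfolding F_def[symmetric] by (simp add: ereal_tendsto_simps)
    qed simp_all
    moreover have "(LBINT u=0..\<infinity>. f u) = (LINT u:{0..}|lborel. f u)"
      unfolding interval_lebesgue_integral_0_infty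
      by (rule set_integral_discrete_difference[of "{0}"]) auto
    moreover have "\<dots> = 2 * s * gaussian_osc n \<phi> s - (\<integral>u. indicator {0..} u * (w' u * cos (2 * u * s + \<phi>)) \<partial>lborel)"
    proof -
      have "(LINT u:{0..}|lborel. f u) = (\<integral>u. 2 * s * (indicator {0..} u * (w n u * sin (2 * u * s + \<phi>)))
        - indicator {0..} u * (w' u * cos (2 * u * s + \<phi>)) \<partial>lborel)"
        unfolding set_lebesgue_integral_def f_def by (intro Bochner_Integration.integral_cong) (auto simp: algebra_simps)
      also have "\<dots> = 2 * s * (\<integral>u. indicator {0..} u * (w n u * sin (2 * u * s + \<phi>)) \<partial>lborel)
          - (\<integral>u. indicator {0..} u * (w' u * cos (2 * u * s + \<phi>)) \<partial>lborel)"
        using i1 i2 by simp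
      also have "(\<integral>u. indicator {0..} u * (w n u * sin (2 * u * s + \<phi>)) \<partial>lborel) = gaussian_osc n \<phi> s"
        by (simp add: gaussian_osc_def gaussian_weight_def w_def mult.assoc)
      finally show ?thesis .
    qed
    ultimately show ?thesis by (simp add: F_def mult.assoc)
  qed
  \<comment> \<open>The boundary term survives only for n = 0, where \<open>w n 0\<close> is
    1.\<close>
  have w0: "\<bar>w n 0 * cos \<phi>\<bar> \<le> 1" by (cases n) (auto simp: w_def)
  have intB: "\<bar>\<integral>u. indicator {0..} u * w' u * cos (2 * u * s + \<phi>) \<partial>lborel\<bar> \<le> B" for s
  proof -
    have "\<bar>\<integral>u. indicator {0..} u * w' u * cos (2 * u * s + \<phi>) \<partial>lborel\<bar> \<le>
        (\<integral>u. \<bar>indicator {0..} u * w' u * cos (2 * u * s + \<phi>)\<bar> \<partial>lborel)"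
      by (rule integral_abs_bound)
    also have "\<dots> \<le> B" unfolding B_def
    proof (rule integral_mono)
      show "integrable lborel (\<lambda>u. \<bar>indicator {0..} u * w' u\<bar>)" using w'_int by simp
      then show "integrable lborel (\<lambda>u. \<bar>indicator {0..} u * w' u * cos (2 * u * s + \<phi>)\<bar>)"
        by (rule Bochner_Integration.integrable_bound)
          (auto simp: w'_def w_def abs_mult indicator_def intro!: mult_left_le)
    qed (auto simp: abs_mult intro!: mult_left_le)
    finally show ?thesis .
  qed
  have "2 * (\<bar>s\<bar> * \<bar>gaussian_osc n \<phi> s\<bar>) \<le> 1 + B" for s
  proof -
    have "2 * (\<bar>s\<bar> * \<bar>gaussian_osc n \<phi> s\<bar>) = \<bar>2 * (s * gaussian_osc n \<phi> s)\<bar>"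
      by (simp add: abs_mult)
    also have "\<dots> \<le> 1 + B"
      unfolding main using w0 intB[of s] by linarith
    finally show ?thesis .
  qed
  then show ?thesis by (intro exI[of _ "(1 + B) / 2"]) (auto simp: field_simps)
qed

subsection \<open>The Hilbert transform on the real line\<close>

text \<open>Dominated convergence with \<bar>f\<bar> as majorant, since the holes shrink to a null
  set; \<epsilon> is written as \<open>inverse y\<close> to turn the limit into one at infinity. It
  disposes of every part of a principal value that is absolutely integrable.\<close>

lemma tendsto_integral_shrinking_hole:
  fixes f :: "real \<Rightarrow> real"
  assumes A: "set_integrable lborel A f"
  shows "((\<lambda>\<epsilon>. LINT s:A - {c - \<epsilon><..<c + \<epsilon>}|lborel. f s) \<longlongrightarrow> (LINT s:A|lborel. f s)) (at_right 0)"
proof -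
  define g where "g = (\<lambda>s. indicator A s *\<^sub>R f s)"
  have g: "integrable lborel g" using A by (simp add: set_integrable_def g_def)
  then have [measurable]: "g \<in> borel_measurable borel" by simp
  have hole: "(LINT s:A - {c - \<epsilon><..<c + \<epsilon>}|lborel. f s) =
      (\<integral>s. indicator (- {c - \<epsilon><..<c + \<epsilon>}) s * g s \<partial>lborel)" for \<epsilon>
    unfolding set_lebesgue_integral_def
    by (intro Bochner_Integration.integral_cong) (auto simp: g_def indicator_def)
  have "((\<lambda>y. \<integral>s. indicator (- {c - inverse y<..<c + inverse y}) s * g s \<partial>lborel)
      \<longlongrightarrow> (\<integral>s. g s \<partial>lborel)) at_top"
  proof (rule integral_dominated_convergence_at_top[where w = "\<lambda>s. \<bar>g s\<bar>"])
    have "((\<lambda>y. indicator (- {c - inverse y<..<c + inverse y}) s * g s) \<longlongrightarrow> g s) at_top"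
      if "s \<noteq> c" for s
    proof (rule tendsto_eventually)
      have "((\<lambda>y::real. inverse y) \<longlongrightarrow> 0) at_top" by real_asymp
      then have "\<forall>\<^sub>F y in at_top. inverse y < \<bar>s - c\<bar>"
        using that by (intro order_tendstoD(2)) auto
      then show "\<forall>\<^sub>F y in at_top. indicator (- {c - inverse y<..<c + inverse y}) s * g s = g s"
        by eventually_elim (auto simp: indicator_def)
    qed
    moreover have "AE s in lborel. s \<noteq> c" by (rule AE_lborel_singleton)
    ultimately show "AE s in lborel. ((\<lambda>y. indicator (- {c - inverse y<..<c + inverse y}) s * g s) \<longlongrightarrow> g s) at_top"
      by (auto elim: eventually_mono)
  qed (use g in \<open>auto simp: indicator_def intro!: always_eventually\<close>)
  then show ?thesis
    by (simp add: filterlim_at_right_to_top hole) (simp add: set_lebesgue_integral_def g_def)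
qed

lemma set_integrable_quadratic_decay:
  fixes f :: "real \<Rightarrow> real"
  assumes [measurable]: "f \<in> borel_measurable borel" "A \<in> sets borel"
  assumes le: "\<And>t. t \<in> A \<Longrightarrow> \<bar>f t\<bar> * (1 + t\<^sup>2) \<le> C"
  shows "set_integrable lborel A f"
proof -
  have "einterval (- \<infinity>) \<infinity> = (UNIV :: real set)" by (auto simp: einterval_def)
  then have "integrable lborel (\<lambda>t::real. inverse (1 + t\<^sup>2))"
    using integrable_inverse_1_plus_square by (simp add: set_integrable_def)
  then have "integrable lborel (\<lambda>t::real. \<bar>C\<bar> * inverse (1 + t\<^sup>2))" by simp
  then show ?thesis
    unfolding set_integrable_def
  proof (rule Bochner_Integration.integrable_bound)
    show "AE t in lborel. norm (indicat_real A t *\<^sub>R f t) \<le> norm (\<bar>C\<bar> * inverse (1 + t\<^sup>2))"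
    proof (intro AE_I2)
      fix t :: real
      have "1 + t\<^sup>2 > 0" by (simp add: add_pos_nonneg)
      then show "norm (indicat_real A t *\<^sub>R f t) \<le> norm (\<bar>C\<bar> * inverse (1 + t\<^sup>2))"
        using le[of t] by (auto simp: indicator_def field_simps)
    qed
  qed measurable
qed

text \<open>The addition formulas separate x from t: the phase stays in the cosine, and t occurs
  only in sin(2ut), which divided by t integrates to the sine integral.\<close>

lemma gaussian_osc_symmetric_difference:
  "gaussian_osc n \<phi> (x + t) - gaussian_osc n \<phi> (x - t) =
     (\<integral>u. gaussian_weight n u * (2 * cos (2 * u * x + \<phi>) * sin (2 * u * t)) \<partial>lborel)"
proof -
  have "sin (2 * u * (x + t) + \<phi>) - sin (2 * u * (x - t) + \<phi>) = 2 * cos (2 * u * x + \<phi>) * sin (2 * u * t)" for u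
  proof -
    have "2 * u * (x + t) + \<phi> = (2 * u * x + \<phi>) + 2 * u * t" "2 * u * (x - t) + \<phi> = (2 * u * x + \<phi>) - 2 * u * t"
      by (auto simp: algebra_simps)
    then show ?thesis by (simp only: sin_add sin_diff)
  qed
  then have "gaussian_weight n u * (2 * cos (2 * u * x + \<phi>) * sin (2 * u * t)) =
      gaussian_weight n u * sin (2 * u * (x + t) + \<phi>) - gaussian_weight n u * sin (2 * u * (x - t) + \<phi>)" for u
    by (metis right_diff_distrib)
  then show ?thesis
    unfolding gaussian_osc_def
    using Bochner_Integration.integral_diff[OF integrable_gaussian_osc[of n "x + t" \<phi>] integrable_gaussian_osc[of n "x - t" \<phi>]]
    by simp
qed

text \<open>Writing D for the numerator, \<bar>D/t\<bar> (1 + t^2) = \<bar>D\<bar>/t +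
  t\<bar>D\<bar> for t > 0. The Lipschitz bound controls the first summand by 2L and the decay
  controls the second.\<close>

lemma set_integrable_symmetric_quotient:
  "set_integrable lborel {0..} (\<lambda>t. (gaussian_osc n \<phi> (x + t) - gaussian_osc n \<phi> (x - t)) / t)"
proof -
  obtain K where K: "\<And>s. \<bar>s\<bar> * \<bar>gaussian_osc n \<phi> s\<bar> \<le> K" using gaussian_osc_decay by blast
  define M where "M = gaussian_moment n"
  define L where "L = 2 * gaussian_moment (n + 1)"
  let ?D = "\<lambda>t. gaussian_osc n \<phi> (x + t) - gaussian_osc n \<phi> (x - t)"
  have xM: "\<bar>x\<bar> * \<bar>gaussian_osc n \<phi> s\<bar> \<le> \<bar>x\<bar> * M" for s
    unfolding M_def by (intro mult_left_mono abs_gaussian_osc_le) auto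
  have "\<bar>?D t / t\<bar> * (1 + t\<^sup>2) \<le> 2 * L + 2 * (K + \<bar>x\<bar> * M)" if "t \<ge> 0" for t
  proof (cases "t = 0")
    \<comment> \<open>Division by 0 gives 0 here, so only the nonnegativity of the bound is at
      stake.\<close>
    case True
    have "M \<ge> 0" "K \<ge> 0" "L \<ge> 0"
      using abs_gaussian_osc_le[of n \<phi> 0] K[of 0] unfolding M_def L_def gaussian_moment_def by (auto intro!: integral_nonneg)
    then show ?thesis using True by simp
  next
    case False
    with that have t: "t > 0" by simp
    have 1: "\<bar>?D t\<bar> \<le> 2 * L * t"
      using gaussian_osc_lipschitz[of n \<phi> "x + t" "x - t"] t by (simp add: L_def)
    \<comment> \<open>For s = x + t and s = x - t one has t \<le> \<bar>s\<bar> + \<bar>x\<bar>; the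
      \<bar>s\<bar> part is covered by the decay and the \<bar>x\<bar> part by boundedness.\<close>
    have tb: "t * \<bar>gaussian_osc n \<phi> s\<bar> \<le> K + \<bar>x\<bar> * M" if "t \<le> \<bar>s\<bar> + \<bar>x\<bar>" for s
    proof -
      have "t * \<bar>gaussian_osc n \<phi> s\<bar> \<le> (\<bar>s\<bar> + \<bar>x\<bar>) * \<bar>gaussian_osc n \<phi> s\<bar>"
        using that by (intro mult_right_mono) auto
      then show ?thesis using K[of s] xM[of s] by (simp add: distrib_right)
    qed
    have "t * \<bar>?D t\<bar> \<le> t * (\<bar>gaussian_osc n \<phi> (x + t)\<bar> + \<bar>gaussian_osc n \<phi> (x - t)\<bar>)"
      using t by (intro mult_left_mono) auto
    also have "\<dots> \<le> 2 * (K + \<bar>x\<bar> * M)"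
      using tb[of "x + t"] tb[of "x - t"] t unfolding distrib_left by linarith
    finally have 2: "t * \<bar>?D t\<bar> \<le> 2 * (K + \<bar>x\<bar> * M)" .
    have "\<bar>?D t / t\<bar> * (1 + t\<^sup>2) = \<bar>?D t\<bar> / t + t * \<bar>?D t\<bar>"
      using t by (simp add: field_simps power2_eq_square)
    also have "\<dots> \<le> 2 * L + 2 * (K + \<bar>x\<bar> * M)"
      using 1 2 t by (intro add_mono) (auto simp: field_simps)
    finally show ?thesis .
  qed
  then show ?thesis by (intro set_integrable_quadratic_decay) auto
qed

lemma gaussian_osc_truncated_transform:
  assumes N: "N \<ge> 0"
  shows "(LINT t:{0..N}|lborel. (gaussian_osc n \<phi> (x + t) - gaussian_osc n \<phi> (x - t)) / t) =
     (\<integral>u. gaussian_weight n u * (2 * cos (2 * u * x + \<phi>)) * (sgn u * Si (N * \<bar>2 * u\<bar>)) \<partial>lborel)"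
proof -
  define f where "f = (\<lambda>t u. indicator {0..N} t * (gaussian_weight n u * (2 * cos (2 * u * x + \<phi>) * sin (2 * u * t)) / t))"
  have f_meas [measurable]: "case_prod f \<in> borel_measurable (lborel \<Otimes>\<^sub>M lborel)"
    unfolding f_def by measurable
  \<comment> \<open>The majorant for Fubini's theorem: \<bar>sin(2ut)\<bar> \<le> 2ut cancels the
    1/t, and with the factor 2 of the symmetric difference this leaves 4u times the weight. It is
    constant in t, so finiteness of N is essential.\<close>
  have "integrable (lborel \<Otimes>\<^sub>M lborel) (\<lambda>(t, u). indicator {0..N} t * (4 * gaussian_weight (n + 1) u))"
  proof (rule lborel_pair.Fubini_integrable)
    show "integrable lborel (\<lambda>t. \<integral>u. norm (case (t, u) of (t, u) \<Rightarrow> indicator {0..N} t * (4 * gaussian_weight (n + 1) u)) \<partial>lborel)"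
      by (auto simp: abs_mult emeasure_lborel_Icc_eq intro!: disjI2 integrable_real_indicator)
  qed (simp_all add: case_prod_beta)
  then have "integrable (lborel \<Otimes>\<^sub>M lborel) (case_prod f)"
  proof (rule Bochner_Integration.integrable_bound)
    have "\<bar>f t u\<bar> \<le> \<bar>indicator {0..N} t * (4 * gaussian_weight (n + 1) u)\<bar>" for t u
    proof (cases "t \<in> {0<..N} \<and> u \<ge> 0")
      case True
      have "\<bar>cos (2 * u * x + \<phi>)\<bar> * \<bar>sin (2 * u * t)\<bar> \<le> 1 * \<bar>2 * u * t\<bar>"
        by (intro mult_mono abs_sin_x_le_abs_x) auto
      then have "gaussian_weight n u * (\<bar>cos (2 * u * x + \<phi>)\<bar> * \<bar>sin (2 * u * t)\<bar>) \<le> gaussian_weight n u * (2 * u * t)"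
        using True by (intro mult_left_mono) (auto simp: abs_mult)
      then show ?thesis
        using True gaussian_weight_add[of n 1 u] by (simp add: f_def abs_mult field_simps)
    next
      case False
      then show ?thesis by (cases "t = 0") (auto simp: f_def gaussian_weight_def indicator_def)
    qed
    then show "AE p in lborel \<Otimes>\<^sub>M lborel. norm (case_prod f p) \<le>
        norm (case p of (t, u) \<Rightarrow> indicator {0..N} t * (4 * gaussian_weight (n + 1) u))"
      by (intro AE_I2) auto
  qed measurable
  then have swap: "(\<integral>u. (\<integral>t. f t u \<partial>lborel) \<partial>lborel) = (\<integral>t. (\<integral>u. f t u \<partial>lborel) \<partial>lborel)"
    by (rule lborel_pair.Fubini_integral)
  have "(\<integral>u. f t u \<partial>lborel) =
      indicator {0..N} t *\<^sub>R ((gaussian_osc n \<phi> (x + t) - gaussian_osc n \<phi> (x - t)) / t)" for t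
    unfolding f_def gaussian_osc_symmetric_difference by simp
  moreover have "(\<integral>t. f t u \<partial>lborel) =
      gaussian_weight n u * (2 * cos (2 * u * x + \<phi>)) * (sgn u * Si (N * \<bar>2 * u\<bar>))" for u
  proof -
    have "(LBINT t=ereal 0..ereal N. sin (t * (2 * u)) / t) = sgn u * Si (N * \<bar>2 * u\<bar>)"
      using LBINT_I0c_sin_scale_divide[OF N, of "2 * u"] by (simp add: sgn_mult zero_ereal_def)
    then have "(\<integral>t. indicator {0..N} t * (sin (2 * u * t) / t) \<partial>lborel) = sgn u * Si (N * \<bar>2 * u\<bar>)"
      using N by (simp add: interval_integral_Icc set_lebesgue_integral_def mult_ac)
    moreover have "f t u = (gaussian_weight n u * (2 * cos (2 * u * x + \<phi>))) * (indicator {0..N} t * (sin (2 * u * t) / t))" for t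
      by (simp add: f_def)
    ultimately show ?thesis by (simp only: integral_mult_right_zero)
  qed
  ultimately show ?thesis using swap by (simp add: set_lebesgue_integral_def)
qed

text \<open>Both sides of the truncated formula converge as N grows: the left by absolute
  integrability, the right by dominated convergence with a bound for Si. The limit pi/2 of Si and
  the factor 2 of the symmetric difference combine to pi.\<close>

lemma integral_symmetric_quotient:
  "(LINT t:{0..}|lborel. (gaussian_osc n \<phi> (x + t) - gaussian_osc n \<phi> (x - t)) / t) =
     pi * gaussian_osc n (\<phi> + pi / 2) x"
proof -
  let ?D = "\<lambda>t. (gaussian_osc n \<phi> (x + t) - gaussian_osc n \<phi> (x - t)) / t"
  let ?v = "\<lambda>u. gaussian_weight n u * (2 * cos (2 * u * x + \<phi>))"
  obtain B where B: "\<And>T. \<bar>Si T\<bar> \<le> B" using bounded_Si by blast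
  have "((\<lambda>N. LINT t:{0..N}|lborel. ?D t) \<longlongrightarrow> (LINT t:{0..}|lborel. ?D t)) at_top"
    by (rule tendsto_set_lebesgue_integral_at_top[OF _ set_integrable_symmetric_quotient]) auto
  moreover have "\<forall>\<^sub>F N in at_top. (LINT t:{0..N}|lborel. ?D t) = (\<integral>u. ?v u * (sgn u * Si (N * \<bar>2 * u\<bar>)) \<partial>lborel)"
    using eventually_ge_at_top[of 0]
    by eventually_elim (rule gaussian_osc_truncated_transform)
  ultimately have "((\<lambda>N. \<integral>u. ?v u * (sgn u * Si (N * \<bar>2 * u\<bar>)) \<partial>lborel) \<longlongrightarrow> (LINT t:{0..}|lborel. ?D t)) at_top"
    by (rule Lim_transform_eventually)
  moreover have "((\<lambda>N. \<integral>u. ?v u * (sgn u * Si (N * \<bar>2 * u\<bar>)) \<partial>lborel) \<longlongrightarrow> (\<integral>u. ?v u * (pi / 2) \<partial>lborel)) at_top"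
  proof (rule integral_dominated_convergence_at_top[where w = "\<lambda>u. gaussian_weight n u * (2 * B)"])
    show "\<forall>\<^sub>F N in at_top. AE u in lborel. norm (?v u * (sgn u * Si (N * \<bar>2 * u\<bar>))) \<le> gaussian_weight n u * (2 * B)"
    proof (intro always_eventually allI AE_I2)
      fix N u :: real
      have "\<bar>cos (2 * u * x + \<phi>)\<bar> * (\<bar>sgn u\<bar> * \<bar>Si (N * \<bar>2 * u\<bar>)\<bar>) \<le> 1 * (1 * B)"
        using B by (intro mult_mono) (auto simp: sgn_if)
      then have "gaussian_weight n u * (2 * (\<bar>cos (2 * u * x + \<phi>)\<bar> * (\<bar>sgn u\<bar> * \<bar>Si (N * \<bar>2 * u\<bar>)\<bar>))) \<le> gaussian_weight n u * (2 * B)"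
        by (intro mult_left_mono) auto
      then show "norm (?v u * (sgn u * Si (N * \<bar>2 * u\<bar>))) \<le> gaussian_weight n u * (2 * B)"
        by (simp add: abs_mult mult_ac)
    qed
    \<comment> \<open>Only u > 0 has content: the weight vanishes for u < 0, and u = 0 is a null
      set.\<close>
    have "((\<lambda>N. ?v u * (sgn u * Si (N * \<bar>2 * u\<bar>))) \<longlongrightarrow> ?v u * (pi / 2)) at_top" if "u \<noteq> 0" for u
    proof (cases "u > 0")
      case True
      then have "filterlim (\<lambda>N. N * \<bar>2 * u\<bar>) at_top at_top" by real_asymp
      from filterlim_compose[OF Si_at_top this] show ?thesis
        using True by (intro tendsto_mult_left) auto
    qed (use that in \<open>simp add: gaussian_weight_def\<close>)
    then show "AE u in lborel. ((\<lambda>N. ?v u * (sgn u * Si (N * \<bar>2 * u\<bar>))) \<longlongrightarrow> ?v u * (pi / 2)) at_top"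
      using AE_lborel_singleton[of "0::real"] by (auto elim: eventually_mono)
  qed simp_all
  ultimately have "(LINT t:{0..}|lborel. ?D t) = (\<integral>u. ?v u * (pi / 2) \<partial>lborel)"
    using tendsto_unique trivial_limit_at_top_linorder by blast
  also have "\<dots> = pi * gaussian_osc n (\<phi> + pi / 2) x"
    by (simp add: gaussian_osc_def sin_add cos_add algebra_simps flip: integral_mult_right_zero)
  finally show ?thesis .
qed


lemma set_integrable_affine_iff:
  fixes f :: "real \<Rightarrow> real"
  assumes "c \<noteq> 0"
  shows "set_integrable lborel A f \<longleftrightarrow> set_integrable lborel {t. x + c * t \<in> A} (\<lambda>t. f (x + c * t))"
proof -
  have "indicat_real {t. x + c * t \<in> A} t = indicator A (x + c * t)" for t
    by (simp add: indicator_def)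
  then show ?thesis
    unfolding set_integrable_def using lborel_integrable_real_affine_iff[OF assms, of "\<lambda>s. indicator A s *\<^sub>R f s" x]
    by simp
qed

lemma set_integral_affine:
  fixes f :: "real \<Rightarrow> real"
  assumes "c \<noteq> 0"
  shows "(LINT s:A|lborel. f s) = \<bar>c\<bar> * (LINT t:{t. x + c * t \<in> A}|lborel. f (x + c * t))"
proof -
  have "indicat_real {t. x + c * t \<in> A} t = indicator A (x + c * t)" for t
    by (simp add: indicator_def)
  then show ?thesis
    unfolding set_lebesgue_integral_def
    by (subst lborel_integral_real_affine[OF assms, of _ x]) simp
qed

lemma set_integrable_gaussian_osc_kernel:
  assumes \<epsilon>: "\<epsilon> > 0"
  shows "set_integrable lborel (UNIV - {x - \<epsilon><..<x + \<epsilon>}) (\<lambda>s. gaussian_osc n \<phi> s / (s - x))"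
proof -
  obtain K where K: "\<And>s. \<bar>s\<bar> * \<bar>gaussian_osc n \<phi> s\<bar> \<le> K" using gaussian_osc_decay by blast
  define M where "M = gaussian_moment n"
  \<comment> \<open>Chosen so that 1 + \<bar>s\<bar> \<le> a\<bar>s - x\<bar> outside the hole: 1 +
    \<bar>s\<bar> \<le> \<bar>s - x\<bar> + (1 + \<bar>x\<bar>), and there 1 \<le> \<bar>s -
    x\<bar>/\<epsilon>.\<close>
  define a where "a = 1 + (1 + \<bar>x\<bar>) / \<epsilon>"
  have "\<bar>gaussian_osc n \<phi> s / (s - x)\<bar> * (1 + s\<^sup>2) \<le> (M + K) * a" if "s \<in> UNIV - {x - \<epsilon><..<x + \<epsilon>}" for s
  proof -
    have far: "\<bar>s - x\<bar> \<ge> \<epsilon>" using that by auto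
    then have pos: "\<bar>s - x\<bar> > 0" using \<epsilon> by linarith
    have "(1 + \<bar>x\<bar>) * 1 \<le> (1 + \<bar>x\<bar>) * (\<bar>s - x\<bar> / \<epsilon>)"
      using far \<epsilon> by (intro mult_left_mono) (auto simp: field_simps)
    moreover have "1 + \<bar>s\<bar> \<le> \<bar>s - x\<bar> + (1 + \<bar>x\<bar>)" by linarith
    ultimately have "1 + \<bar>s\<bar> \<le> \<bar>s - x\<bar> * a"
      by (simp add: a_def algebra_simps add_divide_distrib)
    then have a: "(1 + \<bar>s\<bar>) / \<bar>s - x\<bar> \<le> a"
      using pos by (simp add: field_simps)
    have g: "\<bar>gaussian_osc n \<phi> s\<bar> * (1 + \<bar>s\<bar>) \<le> M + K"
      using K[of s] abs_gaussian_osc_le[of n \<phi> s] by (simp add: M_def algebra_simps)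
    have "1 + s\<^sup>2 \<le> (1 + \<bar>s\<bar>)\<^sup>2" by (simp add: power2_sum)
    then have "\<bar>gaussian_osc n \<phi> s / (s - x)\<bar> * (1 + s\<^sup>2) \<le> \<bar>gaussian_osc n \<phi> s / (s - x)\<bar> * (1 + \<bar>s\<bar>)\<^sup>2"
      by (intro mult_left_mono) auto
    also have "\<dots> = (\<bar>gaussian_osc n \<phi> s\<bar> * (1 + \<bar>s\<bar>)) * ((1 + \<bar>s\<bar>) / \<bar>s - x\<bar>)"
      by (simp add: power2_eq_square)
    also have "\<dots> \<le> (M + K) * a"
      using a g by (intro mult_mono) (auto intro: order_trans[OF _ g])
    finally show ?thesis .
  qed
  then show ?thesis by (intro set_integrable_quadratic_decay) auto
qed

lemma has_pv_integral_gaussian_osc: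
  "has_pv_integral (\<lambda>s. gaussian_osc n \<phi> s / (s - x)) UNIV x (pi * gaussian_osc n (\<phi> + pi / 2) x)"
  unfolding has_pv_integral_def
proof (intro conjI allI impI set_integrable_gaussian_osc_kernel)
  let ?f = "\<lambda>s. gaussian_osc n \<phi> s / (s - x)"
  let ?D = "\<lambda>t. (gaussian_osc n \<phi> (x + t) - gaussian_osc n \<phi> (x - t)) / t"
  \<comment> \<open>The two rays outside the hole are parametrized by s = x + t and s = x - t with t
    \<ge> \<epsilon>, so the truncated integrals agree exactly for every \<epsilon>; no error term
    arises.\<close>
  have "(LINT t:{0..} - {0 - \<epsilon><..<0 + \<epsilon>}|lborel. ?D t) = (LINT s:UNIV - {x - \<epsilon><..<x + \<epsilon>}|lborel. ?f s)"
    if \<epsilon>: "\<epsilon> > 0" for \<epsilon>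
  proof -
    have iR: "set_integrable lborel {x + \<epsilon>..} ?f" and iL: "set_integrable lborel {..x - \<epsilon>} ?f"
      using set_integrable_gaussian_osc_kernel[OF \<epsilon>, of x n \<phi>] \<epsilon> by (auto elim!: set_integrable_subset)
    have sets: "UNIV - {x - \<epsilon><..<x + \<epsilon>} = {x + \<epsilon>..} \<union> {..x - \<epsilon>}" "{0..} - {0 - \<epsilon><..<0 + \<epsilon>} = {\<epsilon>..}"
      "{t. x + 1 * t \<in> {x + \<epsilon>..}} = {\<epsilon>..}" "{t. x + (-1) * t \<in> {..x - \<epsilon>}} = {\<epsilon>..}"
      using \<epsilon> by auto
    have R: "(LINT s:{x + \<epsilon>..}|lborel. ?f s) = (LINT t:{\<epsilon>..}|lborel. gaussian_osc n \<phi> (x + t) / t)"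
      by (subst set_integral_affine[of 1 _ _ x]) (simp_all only: sets, simp_all)
    have L: "(LINT s:{..x - \<epsilon>}|lborel. ?f s) = (LINT t:{\<epsilon>..}|lborel. - (gaussian_osc n \<phi> (x - t) / t))"
      by (subst set_integral_affine[of "-1" _ _ x]) (simp_all only: sets, simp_all)
    have "set_integrable lborel {\<epsilon>..} (\<lambda>t. gaussian_osc n \<phi> (x + t) / t)"
      using iR by (subst (asm) set_integrable_affine_iff[of 1 _ _ x]) (simp_all only: sets, simp_all)
    moreover have "set_integrable lborel {\<epsilon>..} (\<lambda>t. - (gaussian_osc n \<phi> (x - t) / t))"
      using iL by (subst (asm) set_integrable_affine_iff[of "-1" _ _ x]) (simp_all only: sets, simp_all)
    ultimately have "(LINT t:{\<epsilon>..}|lborel. gaussian_osc n \<phi> (x + t) / t + - (gaussian_osc n \<phi> (x - t) / t)) =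
        (LINT s:{x + \<epsilon>..}|lborel. ?f s) + (LINT s:{..x - \<epsilon>}|lborel. ?f s)"
      unfolding R L by (rule set_integral_add)
    also have "\<dots> = (LINT s:{x + \<epsilon>..} \<union> {..x - \<epsilon>}|lborel. ?f s)"
      using \<epsilon> by (intro set_integral_Un[symmetric] iR iL) auto
    finally show ?thesis unfolding sets by (simp add: diff_divide_distrib)
  qed
  then have "\<forall>\<^sub>F \<epsilon> in at_right 0. (LINT t:{0..} - {0 - \<epsilon><..<0 + \<epsilon>}|lborel. ?D t) = (LINT s:UNIV - {x - \<epsilon><..<x + \<epsilon>}|lborel. ?f s)"
    by (auto simp: eventually_at_filter)
  with tendsto_integral_shrinking_hole[OF set_integrable_symmetric_quotient[of n \<phi> x], of 0]
  show "((\<lambda>\<epsilon>. LINT s:UNIV - {x - \<epsilon><..<x + \<epsilon>}|lborel. ?f s) \<longlongrightarrow> pi * gaussian_osc n (\<phi> + pi / 2) x) (at_right 0)"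
    unfolding integral_symmetric_quotient by (rule Lim_transform_eventually)
qed

subsection \<open>From the real line to the half-line\<close>

text \<open>The negative half-line contains no singularity, and s to -s turns its kernel 1/(s - x)
  into \<sigma>/(s + x). Odd h has \<sigma> = 1 and total kernel 2s/(s^2 - x^2); even h has \<sigma>
  = -1 and total kernel 2x/(s^2 - x^2).\<close>

lemma has_pv_integral_half_line:
  fixes h :: "real \<Rightarrow> real"
  assumes parity: "\<And>s. h (- s) = - \<sigma> * h s"
    and x: "x > 0"
    and pv: "has_pv_integral (\<lambda>s. h s / (s - x)) UNIV x I"
  shows "has_pv_integral (\<lambda>s. h s / (s - x) + \<sigma> * h s / (s + x)) {0<..} x I"
proof -
  let ?f = "\<lambda>s. h s / (s - x)" and ?g = "\<lambda>s. \<sigma> * h s / (s + x)"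
  let ?H = "\<lambda>\<epsilon>. {x - \<epsilon><..<x + \<epsilon>}"
  have f_int: "set_integrable lborel (UNIV - ?H \<epsilon>) ?f" if "\<epsilon> > 0" for \<epsilon>
    using pv that by (simp add: has_pv_integral_def)
  have f_lim: "((\<lambda>\<epsilon>. LINT s:UNIV - ?H \<epsilon>|lborel. ?f s) \<longlongrightarrow> I) (at_right 0)"
    using pv by (simp add: has_pv_integral_def)
  \<comment> \<open>The hole of radius x is the interval from 0 to 2x, so its complement contains
    the whole negative half-line.\<close>
  have f_neg: "set_integrable lborel {..0} ?f"
    by (rule set_integrable_subset[OF f_int[OF x]]) (use x in auto)
  have reflect: "h (0 + -1 * s) / (0 + -1 * s - x) = ?g s" for s
  proof -
    have "h (0 + -1 * s) / (0 + -1 * s - x) = (- (\<sigma> * h s)) / (- (s + x))"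
      using parity[of s] by simp
    then show ?thesis by (simp only: minus_divide_divide)
  qed
  have refl_set: "{s::real. 0 + -1 * s \<in> {..0}} = {0..}" by auto
  have g_int: "set_integrable lborel {0..} ?g"
    using f_neg by (subst (asm) set_integrable_affine_iff[of "-1" _ _ 0]) (simp_all only: refl_set reflect)
  have f_neg_eq: "(LINT s:{..0}|lborel. ?f s) = (LINT s:{0..}|lborel. ?g s)"
    using set_integral_affine[of "-1" "{..0}" ?f 0] unfolding refl_set reflect by simp
  have g_int': "set_integrable lborel {0<..} ?g"
    by (rule set_integrable_subset[OF g_int]) auto
  have g_eq: "(LINT s:{0..}|lborel. ?g s) = (LINT s:{0<..}|lborel. ?g s)"
    by (rule set_integral_discrete_difference[of "{0}"]) auto
  have f_pos: "set_integrable lborel ({0<..} - ?H \<epsilon>) ?f" if "\<epsilon> > 0" for \<epsilon>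
    by (rule set_integrable_subset[OF f_int[OF that]]) auto
  have g_pos: "set_integrable lborel ({0<..} - ?H \<epsilon>) ?g" for \<epsilon>
    by (rule set_integrable_subset[OF g_int']) auto
  \<comment> \<open>For \<epsilon> < x the hole stays in the positive half-line. The reflected part
    comes without a hole, and replacing it by its punctured version changes nothing in the
    limit.\<close>
  have split: "(LINT s:UNIV - ?H \<epsilon>|lborel. ?f s) - (LINT s:{0<..}|lborel. ?g s) + (LINT s:{0<..} - ?H \<epsilon>|lborel. ?g s)
      = (LINT s:{0<..} - ?H \<epsilon>|lborel. ?f s + ?g s)" if "\<epsilon> > 0" "\<epsilon> < x" for \<epsilon>
  proof -
    have "UNIV - ?H \<epsilon> = {..0} \<union> ({0<..} - ?H \<epsilon>)" using that by auto
    then have "(LINT s:UNIV - ?H \<epsilon>|lborel. ?f s) = (LINT s:{..0}|lborel. ?f s) + (LINT s:{0<..} - ?H \<epsilon>|lborel. ?f s)"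
      using f_pos[OF that(1)] f_neg by (simp only:) (intro set_integral_Un, auto)
    then show ?thesis
      using set_integral_add(2)[OF f_pos[OF that(1)] g_pos[of \<epsilon>]] f_neg_eq g_eq by simp
  qed
  have "((\<lambda>\<epsilon>. (LINT s:UNIV - ?H \<epsilon>|lborel. ?f s) - (LINT s:{0<..}|lborel. ?g s) + (LINT s:{0<..} - ?H \<epsilon>|lborel. ?g s))
      \<longlongrightarrow> I - (LINT s:{0<..}|lborel. ?g s) + (LINT s:{0<..}|lborel. ?g s)) (at_right 0)"
    by (intro tendsto_intros f_lim tendsto_integral_shrinking_hole g_int')
  moreover have "\<forall>\<^sub>F \<epsilon> in at_right 0. (LINT s:UNIV - ?H \<epsilon>|lborel. ?f s) - (LINT s:{0<..}|lborel. ?g s) + (LINT s:{0<..} - ?H \<epsilon>|lborel. ?g s)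
      = (LINT s:{0<..} - ?H \<epsilon>|lborel. ?f s + ?g s)"
    using eventually_at_right_real[OF x] by eventually_elim (auto intro: split)
  ultimately have "((\<lambda>\<epsilon>. LINT s:{0<..} - ?H \<epsilon>|lborel. ?f s + ?g s) \<longlongrightarrow> I) (at_right 0)"
    using Lim_transform_eventually by force
  then show ?thesis
    unfolding has_pv_integral_def using f_pos g_pos by (auto intro: set_integral_add)
qed

text \<open>The substitution \<open>\<eta> = s\<^sup>2\<close> turns the symmetric hole around \<open>x\<^sup>2\<close> into a hole around
  \<open>x\<close> that is asymmetric only to second order.\<close>
lemma tendsto_integral_square_hole:
  fixes q :: "real \<Rightarrow> real"
  assumes x: "x > 0"
    and pv: "has_pv_integral q {0<..} x I"
    and bound: "\<And>s. s > 0 \<Longrightarrow> s \<noteq> x \<Longrightarrow> \<bar>q s\<bar> \<le> M / \<bar>s - x\<bar>"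
  shows "\<And>\<epsilon>. \<epsilon> > 0 \<Longrightarrow> set_integrable lborel {s. 0 < s \<and> \<epsilon> \<le> \<bar>s\<^sup>2 - x\<^sup>2\<bar>} q"
    and "((\<lambda>\<epsilon>. LINT s:{s. 0 < s \<and> \<epsilon> \<le> \<bar>s\<^sup>2 - x\<^sup>2\<bar>}|lborel. q s) \<longlongrightarrow> I) (at_right 0)"
proof -
  let ?T = "\<lambda>\<epsilon>. {s. 0 < s \<and> \<epsilon> \<le> \<bar>s\<^sup>2 - x\<^sup>2\<bar>}"
  \<comment> \<open>In the variable s the hole reaches from sqrt(x^2 - \<epsilon>) to sqrt(x^2 +
    \<epsilon>). The radius \<delta> makes a symmetric hole with the same right end; by concavity of
    the root its left end lies further right, and \<open>Z\<close> is the strip between the two left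
    ends.\<close>
  define \<delta> where "\<delta> = (\<lambda>\<epsilon>. sqrt (x\<^sup>2 + \<epsilon>) - x)"
  let ?R = "\<lambda>\<epsilon>. {0<..} - {x - \<delta> \<epsilon><..<x + \<delta> \<epsilon>}"
  define Z where "Z = (\<lambda>\<epsilon>. {sqrt (x\<^sup>2 - \<epsilon>)<..x - \<delta> \<epsilon>})"
  have T_meas [measurable]: "?T \<epsilon> \<in> sets borel" for \<epsilon> by measurable
  have \<delta>_pos: "\<delta> \<epsilon> > 0" if "\<epsilon> > 0" for \<epsilon>
  proof -
    have "sqrt (x\<^sup>2) < sqrt (x\<^sup>2 + \<epsilon>)" using that by (intro real_sqrt_less_mono) simp
    then show ?thesis using x by (simp add: \<delta>_def)
  qed
  have \<delta>_eq: "\<delta> \<epsilon> * (2 * x + \<delta> \<epsilon>) = \<epsilon>" if "\<epsilon> > 0" for \<epsilon>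
  proof -
    have "\<delta> \<epsilon> * (2 * x + \<delta> \<epsilon>) = (sqrt (x\<^sup>2 + \<epsilon>))\<^sup>2 - x\<^sup>2"
      by (simp add: \<delta>_def power2_eq_square algebra_simps)
    then show ?thesis using that by simp
  qed
  have T_sub: "?T \<epsilon> \<subseteq> ?R \<epsilon>" if \<epsilon>: "\<epsilon> > 0" for \<epsilon>
  proof
    fix s assume s: "s \<in> ?T \<epsilon>"
    have False if "s \<in> {x - \<delta> \<epsilon><..<x + \<delta> \<epsilon>}"
    proof -
      have "\<bar>s\<^sup>2 - x\<^sup>2\<bar> = \<bar>s - x\<bar> * (s + x)"
        using s x by (simp add: abs_mult square_diff_square_factored power2_eq_square mult.commute)
      also have "\<dots> < \<delta> \<epsilon> * (2 * x + \<delta> \<epsilon>)"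
        using s x that by (intro mult_strict_mono) auto
      finally show False using s \<delta>_eq[OF \<epsilon>] by simp
    qed
    then show "s \<in> ?R \<epsilon>" using s by auto
  qed
  have q_int: "set_integrable lborel (?R \<epsilon>) q" if "\<epsilon> > 0" for \<epsilon>
    using pv \<delta>_pos[OF that] by (simp add: has_pv_integral_def)
  show T_int: "set_integrable lborel (?T \<epsilon>) q" if "\<epsilon> > 0" for \<epsilon>
    using q_int[OF that] by (rule set_integrable_subset) (use T_sub[OF that] in auto)
  \<comment> \<open>On \<open>Z\<close> the distance to x is at least \<delta>, so \<bar>q\<bar>
    \<le> M/\<delta>, and the last factor is the length of \<open>Z\<close>. That length is of order
    \<epsilon>^2 and \<delta> of order \<epsilon>, so the error vanishes in spite of the
    pole.\<close>
  have err: "\<bar>(LINT s:?R \<epsilon>|lborel. q s) - (LINT s:?T \<epsilon>|lborel. q s)\<bar>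
      \<le> M / \<delta> \<epsilon> * (2 * x - sqrt (x\<^sup>2 + \<epsilon>) - sqrt (x\<^sup>2 - \<epsilon>))" if "\<epsilon> > 0" "\<epsilon> < x\<^sup>2" for \<epsilon>
  proof -
    let ?a = "sqrt (x\<^sup>2 - \<epsilon>)" and ?b = "sqrt (x\<^sup>2 + \<epsilon>)"
    have a: "0 < ?a" "?a\<^sup>2 = x\<^sup>2 - \<epsilon>" using that by auto
    have b: "0 < ?b" "?b\<^sup>2 = x\<^sup>2 + \<epsilon>" using that x by (auto simp: add_pos_nonneg)
    \<comment> \<open>The parallelogram identity proves the concavity inequality, as the two squares
      add up to 2x^2.\<close>
    have "(?a + ?b)\<^sup>2 = 2 * ?a\<^sup>2 + 2 * ?b\<^sup>2 - (?a - ?b)\<^sup>2"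
      by (simp only: power2_sum power2_diff)
    also have "\<dots> \<le> (2 * x)\<^sup>2"
      unfolding a(2) b(2) by simp
    finally have "(?a + ?b)\<^sup>2 \<le> (2 * x)\<^sup>2" .
    then have ab: "?a + ?b \<le> 2 * x" by (rule power2_le_imp_le) (use x in simp)
    have Zsub: "Z \<epsilon> \<subseteq> ?R \<epsilon>" using \<delta>_pos[OF that(1)] by (auto simp: Z_def intro: less_trans[OF a(1)])
    have R_eq: "?R \<epsilon> = ?T \<epsilon> \<union> Z \<epsilon>"
    proof (intro equalityI subsetI)
      fix s assume s: "s \<in> ?R \<epsilon>"
      show "s \<in> ?T \<epsilon> \<union> Z \<epsilon>"
      proof (cases "s \<ge> ?b")
        case True
        then have "s\<^sup>2 \<ge> ?b\<^sup>2" using b by (intro power_mono) auto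
        then have "\<epsilon> \<le> \<bar>s\<^sup>2 - x\<^sup>2\<bar>" unfolding b(2) by linarith
        then show ?thesis using s by simp
      next
        case False
        then have "s \<le> x - \<delta> \<epsilon>" using s by (auto simp: \<delta>_def)
        show ?thesis
        proof (cases "s \<le> ?a")
          case True
          then have "s\<^sup>2 \<le> ?a\<^sup>2" using s by (intro power_mono) auto
          then have "\<epsilon> \<le> \<bar>s\<^sup>2 - x\<^sup>2\<bar>" unfolding a(2) by linarith
          then show ?thesis using s by simp
        qed (use \<open>s \<le> x - \<delta> \<epsilon>\<close> in \<open>auto simp: Z_def\<close>)
      qed
    qed (use T_sub[OF that(1)] Zsub in auto)
    have disj: "?T \<epsilon> \<inter> Z \<epsilon> = {}"
    proof -
      have False if "s \<in> ?T \<epsilon>" "s \<in> Z \<epsilon>" for s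
      proof -
        have s: "?a < s" "s < x" using that \<delta>_pos[OF \<open>\<epsilon> > 0\<close>] by (auto simp: Z_def)
        have "?a\<^sup>2 < s\<^sup>2" by (rule power_strict_mono[OF s(1)]) (use a(1) in linarith, simp)
        moreover have "s\<^sup>2 < x\<^sup>2" by (rule power_strict_mono[OF s(2)]) (use that(1) in simp, simp)
        ultimately show False using that(1) unfolding a(2) by auto
      qed
      then show ?thesis by blast
    qed
    have Z_int: "set_integrable lborel (Z \<epsilon>) q"
      using q_int[OF that(1)] by (rule set_integrable_subset) (use Zsub in \<open>auto simp: Z_def\<close>)
    have "(LINT s:?R \<epsilon>|lborel. q s) - (LINT s:?T \<epsilon>|lborel. q s) = (LINT s:Z \<epsilon>|lborel. q s)"
      unfolding R_eq using set_integral_Un[OF disj T_int[OF that(1)] Z_int] by simp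
    moreover have "\<bar>LINT s:Z \<epsilon>|lborel. q s\<bar> \<le> (LINT s:Z \<epsilon>|lborel. M / \<delta> \<epsilon>)"
    proof -
      have "\<bar>LINT s:Z \<epsilon>|lborel. q s\<bar> \<le> (LINT s:Z \<epsilon>|lborel. \<bar>q s\<bar>)"
        using set_integral_norm_bound[OF Z_int] by simp
      also have "\<dots> \<le> (LINT s:Z \<epsilon>|lborel. M / \<delta> \<epsilon>)"
      proof (rule set_integral_mono)
        show "set_integrable lborel (Z \<epsilon>) (\<lambda>s. \<bar>q s\<bar>)" using Z_int by (rule set_integrable_abs)
        show "set_integrable lborel (Z \<epsilon>) (\<lambda>s. M / \<delta> \<epsilon>)"
          unfolding Z_def set_integrable_def \<delta>_def using ab by (auto intro!: integrable_real_indicator)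
        fix s assume s: "s \<in> Z \<epsilon>"
        then have "s > 0" by (auto simp: Z_def intro: less_trans[OF a(1)])
        have "\<bar>s - x\<bar> \<ge> \<delta> \<epsilon>" using s by (auto simp: Z_def)
        \<comment> \<open>The sign of \<open>M\<close> is read off \<open>bound\<close> at a sample
          point, here 2x.\<close>
        have "0 \<le> M / \<bar>2 * x - x\<bar>" using bound[of "2 * x"] x by linarith
        then have "M \<ge> 0" using x by (simp add: zero_le_divide_iff)
        have "\<bar>q s\<bar> \<le> M / \<bar>s - x\<bar>" using \<open>s > 0\<close> \<open>\<bar>s - x\<bar> \<ge> \<delta> \<epsilon>\<close> \<delta>_pos[OF that(1)] by (intro bound) auto
        also have "\<dots> \<le> M / \<delta> \<epsilon>"
          using \<open>M \<ge> 0\<close> \<open>\<bar>s - x\<bar> \<ge> \<delta> \<epsilon>\<close> \<delta>_pos[OF that(1)] by (intro divide_left_mono) auto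
        finally show "\<bar>q s\<bar> \<le> M / \<delta> \<epsilon>" .
      qed
      finally show ?thesis .
    qed
    moreover have "(LINT s:Z \<epsilon>|lborel. M / \<delta> \<epsilon>) = M / \<delta> \<epsilon> * (2 * x - ?b - ?a)"
      using ab by (simp add: Z_def \<delta>_def set_lebesgue_integral_def)
    ultimately show ?thesis by linarith
  qed
  have "((\<lambda>\<epsilon>. M / \<delta> \<epsilon> * (2 * x - sqrt (x\<^sup>2 + \<epsilon>) - sqrt (x\<^sup>2 - \<epsilon>))) \<longlongrightarrow> 0) (at_right 0)"
    unfolding \<delta>_def using x by real_asymp
  moreover have "\<forall>\<^sub>F \<epsilon> in at_right 0. norm ((LINT s:?R \<epsilon>|lborel. q s) - (LINT s:?T \<epsilon>|lborel. q s))
      \<le> M / \<delta> \<epsilon> * (2 * x - sqrt (x\<^sup>2 + \<epsilon>) - sqrt (x\<^sup>2 - \<epsilon>))"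
    using eventually_at_right_real[of 0 "x\<^sup>2", OF zero_less_power[OF x]]
    by eventually_elim (simp only: real_norm_def, rule err, auto)
  ultimately have "((\<lambda>\<epsilon>. (LINT s:?R \<epsilon>|lborel. q s) - (LINT s:?T \<epsilon>|lborel. q s)) \<longlongrightarrow> 0) (at_right 0)"
    by (rule Lim_null_comparison[rotated])
  moreover have "filterlim \<delta> (at_right 0) (at_right 0)"
  proof -
    have "(\<delta> \<longlongrightarrow> 0) (at_right 0)" unfolding \<delta>_def using x by real_asymp
    then show ?thesis
      using \<delta>_pos by (fastforce simp: filterlim_at eventually_at_filter intro!: always_eventually)
  qed
  then have "((\<lambda>\<epsilon>. LINT s:?R \<epsilon>|lborel. q s) \<longlongrightarrow> I) (at_right 0)"
    by (rule filterlim_compose[rotated]) (use pv in \<open>simp add: has_pv_integral_def\<close>)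
  ultimately show "((\<lambda>\<epsilon>. LINT s:?T \<epsilon>|lborel. q s) \<longlongrightarrow> I) (at_right 0)"
    using tendsto_diff[of "\<lambda>\<epsilon>. LINT s:?R \<epsilon>|lborel. q s" I "at_right 0" "\<lambda>\<epsilon>. (LINT s:?R \<epsilon>|lborel. q s) - (LINT s:?T \<epsilon>|lborel. q s)" 0]
    by simp
qed

lemma set_integral_square_substitution:
  fixes F q :: "real \<Rightarrow> real"
  assumes [measurable]: "q \<in> borel_measurable borel" "T \<in> sets borel" "A \<in> sets borel"
    and T: "T \<subseteq> {0<..}" and A: "(\<lambda>s. s\<^sup>2) ` T = A"
    and F: "\<And>s. s \<in> T \<Longrightarrow> 2 * s * F (s\<^sup>2) = q s"
    and q: "set_integrable lborel T q"
  shows "set_integrable lborel A F" "(LINT \<eta>:A|lborel. F \<eta>) = (LINT s:T|lborel. q s)"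
proof -
  \<comment> \<open>\<open>F\<close> is known only through its values on \<open>A\<close>;
    \<open>F'\<close> has these values there and inherits Borel measurability from
    \<open>q\<close>.\<close>
  define F' where "F' = (\<lambda>\<eta>. q (sqrt \<eta>) / (2 * sqrt \<eta>))"
  have [measurable]: "F' \<in> borel_measurable borel" unfolding F'_def by measurable
  have F': "F' \<eta> = F \<eta>" if "\<eta> \<in> A" for \<eta>
  proof -
    obtain s where s: "s \<in> T" "\<eta> = s\<^sup>2" using \<open>\<eta> \<in> A\<close> unfolding A[symmetric] by blast
    then have "s > 0" using T by auto
    then show ?thesis using F[OF s(1)] s(2) by (simp add: F'_def field_simps)
  qed
  have qT: "\<bar>2 * s\<bar> * F' (s\<^sup>2) = q s" if "s \<in> T" for s
    using that T by (auto simp: F'_def)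
  \<comment> \<open>The change of variables theorem speaks of Lebesgue measure; for Borel functions
    and sets its integrals agree with those over \<open>lborel\<close>.\<close>
  have leb: "set_integrable lebesgue B f \<longleftrightarrow> set_integrable lborel B f"
     "(LINT s:B|lebesgue. f s) = (LINT s:B|lborel. f s)"
    if [measurable]: "f \<in> borel_measurable borel" "B \<in> sets borel" for f :: "real \<Rightarrow> real" and B
    unfolding set_integrable_def set_lebesgue_integral_def
    by (simp_all add: integrable_completion integral_completion)
  have qT_int: "(\<lambda>s. \<bar>2 * s\<bar> * F' (s\<^sup>2)) absolutely_integrable_on T"
  proof (subst set_integrable_cong[OF refl refl qT])
    show "q absolutely_integrable_on T" using q by (simp add: leb)
  qed
  have int_eq: "integral T (\<lambda>s. \<bar>2 * s\<bar> * F' (s\<^sup>2)) = (LINT s:T|lborel. q s)"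
  proof -
    have "integral T (\<lambda>s. \<bar>2 * s\<bar> * F' (s\<^sup>2)) = integral T q"
      by (rule Henstock_Kurzweil_Integration.integral_cong) (rule qT)
    also have "\<dots> = (LINT s:T|lebesgue. q s)"
      using q by (intro set_lebesgue_integral_eq_integral(2)[symmetric]) (simp add: leb)
    finally show ?thesis by (simp add: leb)
  qed
  have "F' absolutely_integrable_on (\<lambda>s. s\<^sup>2) ` T \<and> integral ((\<lambda>s. s\<^sup>2) ` T) F' = (LINT s:T|lborel. q s)"
  proof (rule has_absolute_integral_change_of_variables_1'[THEN iffD1])
    show "((\<lambda>s. s\<^sup>2) has_real_derivative 2 * s) (at s within T)" for s :: real
      by (auto intro!: derivative_eq_intros)
    show "inj_on (\<lambda>s. s\<^sup>2) T"
    proof (rule inj_onI)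
      fix s t assume st: "s \<in> T" "t \<in> T" and "s\<^sup>2 = t\<^sup>2"
      moreover have "s > 0" "t > 0" using st T by auto
      ultimately show "s = t" by (simp add: power2_eq_iff_nonneg)
    qed
  qed (use qT_int int_eq in auto)
  then have F'_int: "F' absolutely_integrable_on A" and F'_eq: "integral A F' = (LINT s:T|lborel. q s)"
    unfolding A by auto
  have "set_integrable lborel A F'" using F'_int by (simp add: leb)
  then show "set_integrable lborel A F" by (subst (asm) set_integrable_cong[OF refl refl F'])
  have "(LINT \<eta>:A|lborel. F \<eta>) = (LINT \<eta>:A|lborel. F' \<eta>)"
    by (rule set_lebesgue_integral_cong) (auto simp: F')
  also have "\<dots> = (LINT s:T|lborel. q s)"
    using set_lebesgue_integral_eq_integral(2)[OF F'_int] F'_eq by (simp add: leb)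
  finally show "(LINT \<eta>:A|lborel. F \<eta>) = (LINT s:T|lborel. q s)" .
qed

text \<open>The free \<sigma> and c let one statement serve both formulas. The factor 2s in
  hypothesis \<open>F\<close> is the Jacobian of \<eta> = s^2, so this hypothesis is a partial
  fraction identity for the transformed integrand.\<close>

lemma has_pv_integral_square_substitution:
  fixes h F :: "real \<Rightarrow> real"
  assumes [measurable]: "h \<in> borel_measurable borel"
    and M: "\<And>s. \<bar>h s\<bar> \<le> M"
    and \<sigma>: "\<bar>\<sigma>\<bar> = 1" and parity: "\<And>s. h (- s) = - \<sigma> * h s"
    and x: "x > 0"
    and pv: "has_pv_integral (\<lambda>s. h s / (s - x)) UNIV x I"
    and F: "\<And>s. s > 0 \<Longrightarrow> s \<noteq> x \<Longrightarrow> 2 * s * F (s\<^sup>2) = c * (h s / (s - x) + \<sigma> * h s / (s + x))"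
  shows "has_pv_integral F {0<..} (x\<^sup>2) (c * I)"
proof -
  define q where "q = (\<lambda>s. h s / (s - x) + \<sigma> * h s / (s + x))"
  have [measurable]: "q \<in> borel_measurable borel" unfolding q_def by measurable
  have pvq: "has_pv_integral q {0<..} x I"
    unfolding q_def using parity x pv by (rule has_pv_integral_half_line)
  have bound: "\<bar>q s\<bar> \<le> 2 * M / \<bar>s - x\<bar>" if "s > 0" "s \<noteq> x" for s
  proof -
    have "M \<ge> 0" using M[of 0] by linarith
    have "\<bar>q s\<bar> \<le> \<bar>h s\<bar> / \<bar>s - x\<bar> + \<bar>h s\<bar> / \<bar>s + x\<bar>"
      unfolding q_def using \<sigma> abs_triangle_ineq[of "h s / (s - x)" "\<sigma> * h s / (s + x)"] by (simp add: abs_mult)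
    \<comment> \<open>As s and x are positive, \<bar>s - x\<bar> \<le> \<bar>s + x\<bar>, so the
      reflected term obeys the same simple-pole bound.\<close>
    also have "\<dots> \<le> M / \<bar>s - x\<bar> + M / \<bar>s - x\<bar>"
      using that x M[of s] \<open>M \<ge> 0\<close> by (intro add_mono frac_le) auto
    finally show ?thesis by simp
  qed
  let ?T = "\<lambda>\<epsilon>. {s. 0 < s \<and> \<epsilon> \<le> \<bar>s\<^sup>2 - x\<^sup>2\<bar>}"
  have T_int: "set_integrable lborel (?T \<epsilon>) q" if "\<epsilon> > 0" for \<epsilon>
    using x pvq bound that by (rule tendsto_integral_square_hole(1))
  have T_lim: "((\<lambda>\<epsilon>. LINT s:?T \<epsilon>|lborel. q s) \<longlongrightarrow> I) (at_right 0)"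
    using x pvq bound by (rule tendsto_integral_square_hole(2))
  let ?A = "\<lambda>\<epsilon>. {0<..} - {x\<^sup>2 - \<epsilon><..<x\<^sup>2 + \<epsilon>}"
  have subst: "set_integrable lborel (?A \<epsilon>) F \<and> (LINT \<eta>:?A \<epsilon>|lborel. F \<eta>) = c * (LINT s:?T \<epsilon>|lborel. q s)"
    if \<epsilon>: "\<epsilon> > 0" for \<epsilon>
  proof -
    have image: "(\<lambda>s. s\<^sup>2) ` ?T \<epsilon> = ?A \<epsilon>"
    proof (intro equalityI subsetI)
      fix \<eta> assume "\<eta> \<in> ?A \<epsilon>"
      then show "\<eta> \<in> (\<lambda>s. s\<^sup>2) ` ?T \<epsilon>"
        by (intro image_eqI[of _ _ "sqrt \<eta>"]) auto
    qed auto
    have Fq: "2 * s * F (s\<^sup>2) = c * q s" if "s \<in> ?T \<epsilon>" for s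
      unfolding q_def using that \<epsilon> by (intro F) auto
    have cq: "set_integrable lborel (?T \<epsilon>) (\<lambda>s. c * q s)"
      using T_int[OF \<epsilon>] by simp
    have sets: "?T \<epsilon> \<in> sets borel" "?A \<epsilon> \<in> sets borel" "?T \<epsilon> \<subseteq> {0<..}" by auto
    have meas: "(\<lambda>s. c * q s) \<in> borel_measurable borel" by measurable
    have "set_integrable lborel (?A \<epsilon>) F"
      using meas sets image Fq cq by (rule set_integral_square_substitution(1))
    moreover have "(LINT \<eta>:?A \<epsilon>|lborel. F \<eta>) = (LINT s:?T \<epsilon>|lborel. c * q s)"
      using meas sets image Fq cq by (rule set_integral_square_substitution(2))
    ultimately show ?thesis by simp
  qed
  then have "\<forall>\<^sub>F \<epsilon> in at_right 0. c * (LINT s:?T \<epsilon>|lborel. q s) = (LINT \<eta>:?A \<epsilon>|lborel. F \<eta>)"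
    by (auto simp: eventually_at_filter)
  with tendsto_mult_left[OF T_lim, of c] have "((\<lambda>\<epsilon>. LINT \<eta>:?A \<epsilon>|lborel. F \<eta>) \<longlongrightarrow> c * I) (at_right 0)"
    by (rule Lim_transform_eventually)
  then show ?thesis unfolding has_pv_integral_def using subst by simp
qed

section \<open>Laguerre polynomials and the numerators as oscillatory integrals\<close>

lemma gaussian_osc_even_laguerre:
  "gaussian_osc (2 * m) (pi / 2) x = sqrt pi / 2 * fact m * exp (- x\<^sup>2) * laguerre m (-1/2) (x\<^sup>2)"
proof -
  have "gaussian_osc (2 * m) (pi / 2) x =
      sqrt pi / 2 * pochhammer (1/2) m * confluent_hyp (real m + 1/2) (1/2) (- x\<^sup>2)"
    by (simp add: gaussian_osc_cos gaussian_moment_even add_divide_distrib)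
  moreover have "confluent_hyp (real m + 1/2) (1/2) (- x\<^sup>2) = exp (- x\<^sup>2) * confluent_hyp (- real m) (1/2) (x\<^sup>2)"
    using confluent_hyp_kummer[of "1/2" "x\<^sup>2" "real m + 1/2"] by simp
  ultimately show ?thesis
    by (simp add: laguerre_eq_confluent_hyp)
qed

lemma gaussian_osc_odd_laguerre:
  "gaussian_osc (2 * m + 1) 0 x = sqrt pi / 2 * fact m * x * exp (- x\<^sup>2) * laguerre m (1/2) (x\<^sup>2)"
proof -
  \<comment> \<open>The even moment 2m + 2 carries (1/2)_(m+1) = (1/2) (3/2)_m, and (3/2)_m is the
    normalization of the Laguerre polynomial with parameter 1/2.\<close>
  have "gaussian_moment (2 * m + 2) = sqrt pi / 4 * pochhammer (3/2) m"
    using gaussian_moment_even[of "m + 1"] by (simp add: pochhammer_rec)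
  moreover have "gaussian_osc (2 * m + 1) 0 x =
      2 * x * gaussian_moment (2 * m + 2) * confluent_hyp (real m + 3/2) (3/2) (- x\<^sup>2)"
    using gaussian_osc_sin[of "2 * m + 1" x] by (simp add: add_divide_distrib add_ac)
  moreover have "confluent_hyp (real m + 3/2) (3/2) (- x\<^sup>2) = exp (- x\<^sup>2) * confluent_hyp (- real m) (3/2) (x\<^sup>2)"
    using confluent_hyp_kummer[of "3/2" "x\<^sup>2" "real m + 3/2"] by simp
  ultimately show ?thesis
    by (simp add: laguerre_eq_confluent_hyp)
qed

text \<open>The sine contributes an extra power of u, so the odd moment 2m + 1 appears; its value is
  the origin of the factorial.\<close>

lemma gaussian_osc_even_confluent_hyp:
  "s * (exp (- s\<^sup>2) * confluent_hyp (1/2 - real m) (3/2) (s\<^sup>2)) = gaussian_osc (2 * m) 0 s / fact m"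
proof -
  have "exp (- s\<^sup>2) * confluent_hyp (1/2 - real m) (3/2) (s\<^sup>2) = confluent_hyp (real m + 1) (3/2) (- s\<^sup>2)"
    using confluent_hyp_kummer[of "3/2" "s\<^sup>2" "real m + 1"] by simp
  moreover have mom: "gaussian_moment (Suc (2 * m)) = fact m / 2"
    using gaussian_moment_odd[of m] by (simp del: eq_divide_eq_numeral1)
  ultimately show ?thesis
    by (simp add: gaussian_osc_sin mom add_divide_distrib add_ac)
qed

lemma gaussian_osc_odd_confluent_hyp:
  "exp (- s\<^sup>2) * confluent_hyp (-1/2 - real m) (1/2) (s\<^sup>2) = 2 * gaussian_osc (2 * m + 1) (pi / 2) s / fact m"
proof -
  have "exp (- s\<^sup>2) * confluent_hyp (-1/2 - real m) (1/2) (s\<^sup>2) = confluent_hyp (real m + 1) (1/2) (- s\<^sup>2)"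
    using confluent_hyp_kummer[of "1/2" "s\<^sup>2" "real m + 1"] by simp
  moreover have mom: "gaussian_moment (Suc (2 * m)) = fact m / 2"
    using gaussian_moment_odd[of m] by (simp del: eq_divide_eq_numeral1)
  ultimately show ?thesis
    by (simp add: gaussian_osc_cos mom add_divide_distrib add_ac)
qed

lemma gaussian_osc_pi: "gaussian_osc n (\<phi> + pi) s = - gaussian_osc n \<phi> s"
  by (simp add: gaussian_osc_def add.assoc[symmetric])

lemma gaussian_osc_0_minus: "gaussian_osc n 0 (- s) = - gaussian_osc n 0 s"
  by (simp add: gaussian_osc_def)

lemma gaussian_osc_pi_half_minus: "gaussian_osc n (pi / 2) (- s) = gaussian_osc n (pi / 2) s"
  by (simp add: gaussian_osc_def sin_add sin_diff)

theorem mainTheorem5: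
  fixes m :: nat and \<xi> :: real
  assumes "0 < \<xi>"
  shows "pv_integrable
           (\<lambda>\<eta>. sqrt \<eta> * exp (-\<eta>) * confluent_hyp (1/2 - real m) (3/2) \<eta> / (\<eta> - \<xi>)) {0<..} \<xi> \<and>
         1 / pi * pv_integral
           (\<lambda>\<eta>. sqrt \<eta> * exp (-\<eta>) * confluent_hyp (1/2 - real m) (3/2) \<eta> / (\<eta> - \<xi>)) {0<..} \<xi>
           = sqrt pi / 2 * exp (-\<xi>) * laguerre m (-1/2) \<xi> \<and>
         pv_integrable
           (\<lambda>\<eta>. exp (-\<eta>) * confluent_hyp (-1/2 - real m) (1/2) \<eta> / (sqrt \<eta> * (\<eta> - \<xi>))) {0<..} \<xi> \<and>
         1 / pi * pv_integral
           (\<lambda>\<eta>. exp (-\<eta>) * confluent_hyp (-1/2 - real m) (1/2) \<eta> / (sqrt \<eta> * (\<eta> - \<xi>))) {0<..} \<xi>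
           = - sqrt pi * exp (-\<xi>) * laguerre m (1/2) \<xi>"
proof -
  define x where "x = sqrt \<xi>"
  have x: "x > 0" "x\<^sup>2 = \<xi>" using assms by (auto simp: x_def)
  let ?F = "\<lambda>\<eta>. sqrt \<eta> * exp (-\<eta>) * confluent_hyp (1/2 - real m) (3/2) \<eta> / (\<eta> - \<xi>)"
  let ?G = "\<lambda>\<eta>. exp (-\<eta>) * confluent_hyp (-1/2 - real m) (1/2) \<eta> / (sqrt \<eta> * (\<eta> - \<xi>))"
  have partial: "s\<^sup>2 - \<xi> = (s - x) * (s + x)" for s
    by (simp add: x(2)[symmetric] power2_eq_square algebra_simps)
  \<comment> \<open>The root of \<eta> supplies the factor s that makes the numerator the odd sine
    transform; the Jacobian then gives 2s/(s^2 - x^2) = 1/(s - x) + 1/(s + x), so \<sigma> =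
    1.\<close>
  have "has_pv_integral ?F {0<..} (x\<^sup>2) (1 / fact m * (pi * gaussian_osc (2 * m) (0 + pi / 2) x))"
  proof (rule has_pv_integral_square_substitution[where \<sigma> = 1])
    show "has_pv_integral (\<lambda>s. gaussian_osc (2 * m) 0 s / (s - x)) UNIV x (pi * gaussian_osc (2 * m) (0 + pi / 2) x)"
      by (rule has_pv_integral_gaussian_osc)
    fix s :: real assume s: "s > 0" "s \<noteq> x"
    have "2 * s * ?F (s\<^sup>2) = 2 * s * (s * (exp (- s\<^sup>2) * confluent_hyp (1/2 - real m) (3/2) (s\<^sup>2))) / ((s - x) * (s + x))"
      using s by (simp add: partial)
    also have "\<dots> = 1 / fact m * (gaussian_osc (2 * m) 0 s / (s - x) + 1 * gaussian_osc (2 * m) 0 s / (s + x))"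
      unfolding gaussian_osc_even_confluent_hyp using s x(1) by (simp add: divide_simps) (simp add: algebra_simps)
    finally show "2 * s * ?F (s\<^sup>2) =
        1 / fact m * (gaussian_osc (2 * m) 0 s / (s - x) + 1 * gaussian_osc (2 * m) 0 s / (s + x))" .
  qed (use x(1) abs_gaussian_osc_le in \<open>auto simp: gaussian_osc_0_minus\<close>)
  moreover have "1 / fact m * (pi * gaussian_osc (2 * m) (0 + pi / 2) x) =
      pi * (sqrt pi / 2 * exp (-\<xi>) * laguerre m (-1/2) \<xi>)"
    by (simp add: gaussian_osc_even_laguerre x(2))
  ultimately have F: "has_pv_integral ?F {0<..} \<xi> (pi * (sqrt pi / 2 * exp (-\<xi>) * laguerre m (-1/2) \<xi>))"
    by (simp only: x(2))
  \<comment> \<open>The root of \<eta> in the denominator cancels the s of the Jacobian, so the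
    numerator is even and 2x/(s^2 - x^2) = 1/(s - x) - 1/(s + x) applies with \<sigma> = -1. This
    puts x into the denominator of the constant, to be cancelled by the x in
    \<open>gaussian_osc_odd_laguerre\<close>.\<close>
  have "has_pv_integral ?G {0<..} (x\<^sup>2) (2 / (x * fact m) * (pi * gaussian_osc (2 * m + 1) (pi / 2 + pi / 2) x))"
  proof (rule has_pv_integral_square_substitution[where \<sigma> = "-1"])
    show "has_pv_integral (\<lambda>s. gaussian_osc (2 * m + 1) (pi / 2) s / (s - x)) UNIV x
        (pi * gaussian_osc (2 * m + 1) (pi / 2 + pi / 2) x)"
      by (rule has_pv_integral_gaussian_osc)
    fix s :: real assume s: "s > 0" "s \<noteq> x"
    have "2 * s * ?G (s\<^sup>2) = 2 * (exp (- s\<^sup>2) * confluent_hyp (-1/2 - real m) (1/2) (s\<^sup>2)) / ((s - x) * (s + x))"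
      using s by (simp add: partial)
    also have "\<dots> = 2 / (x * fact m) * (gaussian_osc (2 * m + 1) (pi / 2) s / (s - x)
        + -1 * gaussian_osc (2 * m + 1) (pi / 2) s / (s + x))"
      unfolding gaussian_osc_odd_confluent_hyp using s x(1) by (simp add: divide_simps) (simp add: algebra_simps)
    finally show "2 * s * ?G (s\<^sup>2) = 2 / (x * fact m) * (gaussian_osc (2 * m + 1) (pi / 2) s / (s - x)
        + -1 * gaussian_osc (2 * m + 1) (pi / 2) s / (s + x))" .
  qed (use x(1) abs_gaussian_osc_le in \<open>auto simp: gaussian_osc_pi_half_minus\<close>)
  moreover have "2 / (x * fact m) * (pi * gaussian_osc (2 * m + 1) (pi / 2 + pi / 2) x) =
      pi * (- sqrt pi * exp (-\<xi>) * laguerre m (1/2) \<xi>)"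
  proof -
    have "gaussian_osc (2 * m + 1) (pi / 2 + pi / 2) x = - gaussian_osc (2 * m + 1) 0 x"
      using gaussian_osc_pi[of "2 * m + 1" 0 x] by simp
    then show ?thesis
      unfolding gaussian_osc_odd_laguerre using x(1) by (simp add: x(2))
  qed
  ultimately have G: "has_pv_integral ?G {0<..} \<xi> (pi * (- sqrt pi * exp (-\<xi>) * laguerre m (1/2) \<xi>))"
    by (simp only: x(2))
  show ?thesis
    unfolding pv_integral_eqI[OF F] pv_integral_eqI[OF G]
    using F G by (auto simp: pv_integrable_def)
qed

end
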